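(* Let $(X,\mathcal{B},\mu,T)$ be an invertible MDS and $(Y,\mathcal{D},\nu,S)$ an ergodic MDS. If $\tau>\overline{D}_\nu(Y,S)$ for every $\tau\in \mathrm{Dims}_\mu(X,T)$, then $(X,\mathcal{B},\mu,T)$ is disjoint from $(Y,\mathcal{D},\nu,S)$.
   Context: An MDS $(X,\mathcal{B},\mu,T)$ is a probability space with a measurable $\mu$-preserving map $T:X\to X$. $\mathcal{P}_X$ is the collection of finite measurable partitions of $X$; $H_\mu$ is Shannon entropy; $\mathbb{N}=\{1,2,\dots\}$. For an increasing sequence $S=\{s_1<s_2<\cdots\}\subset\mathbb{N}$ its upper dimension is $\overline{D}(S)=\inf\{\tau\ge0:\limsup_{n\to\infty} n/(s_n)^\tau=0\}$. $S$ is an entropy generating sequence of $\alpha\in\mathcal{P}_X$ if $\liminf_{n\to\infty}\frac1n H_\mu(\bigvee_{i=1}^n T^{-s_i}\alpha)>0$. The upper entropy dimension of $\alpha$, $\overline{D}_\mu(T,\alpha)$, is the supremum of $\overline{D}(S)$ over all entropy generating sequences $S$ of $\alpha$ ($0$ if there are none). The upper metric entropy dimension is $\overline{D}_\mu(X,T)=\sup_{\alpha\in\mathcal{P}_X}\overline{D}_\mu(T,\alpha)$. The dimension set is $\mathrm{Dims}_\mu(X,T)=\{\overline{D}_\mu(T,\{A,X\setminus A\}): A\in\mathcal{B},\ 0<\mu(A)<1\}$. A joining of $(X,\mathcal{B},\mu,T)$ and $(Y,\mathcal{D},\nu,S)$ is a $T\times S$-invariant probability measure on $(X\times Y,\mathcal{B}\times\mathcal{D})$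 with marginals $\mu$ and $\nu$. The two systems are disjoint if $\mu\times\nu$ is their only joining. *)

theory Defs
  imports "HOL-Probability.Probability" "HOL-Library.Disjoint_Sets"
begin

section \<open>Measure-preserving systems\<close>

locale mds = prob_space M for M :: "'a measure" +
  fixes T :: "'a \<Rightarrow> 'a"
  assumes measurable_T: "T \<in> M \<rightarrow>\<^sub>M M"
    and preserves_T: "distr M M T = M"

locale invertible_mds = mds +
  assumes bij_T: "bij_betw T (space M) (space M)"
    and measurable_inv_T: "the_inv_into (space M) T \<in> M \<rightarrow>\<^sub>M M"

locale ergodic_mds = mds +
  assumes ergodic: "A \<in> sets M \<Longrightarrow> T -` A \<inter> space M = A \<Longrightarrow> measure M A = 0 \<or> measure M A = 1"

section \<open>Finite partitions and Shannon entropy\<close>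

definition finite_partitions :: "'a measure \<Rightarrow> 'a set set set" where
  "finite_partitions M = {\<alpha>. finite \<alpha> \<and> \<alpha> \<subseteq> sets M \<and> partition_on (space M) \<alpha>}"

text \<open>Cells of a library partition are nonempty. As \<open>T\<close> need not be surjective, a preimage of
  a cell may be empty, and it is then dropped; it would contribute nothing to the entropy.\<close>

definition pullback_partition :: "'a measure \<Rightarrow> ('a \<Rightarrow> 'a) \<Rightarrow> nat \<Rightarrow> 'a set set \<Rightarrow> 'a set set" where
  "pullback_partition M T k \<alpha> = (\<lambda>A. (T ^^ k) -` A \<inter> space M) ` \<alpha> - {{}}"

definition shannon_entropy :: "'a measure \<Rightarrow> 'a set set \<Rightarrow> real" where
  "shannon_entropy M \<alpha> = - (\<Sum>A\<in>\<alpha>. measure M A * ln (measure M A))"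

section \<open>Entropy dimension\<close>

text \<open>A sequence \<open>s\<^sub>1 < s\<^sub>2 < \<dots>\<close> of positive integers is encoded with indices shifted
  by one: \<open>s n\<close> stands for the term with index \<open>n + 1\<close>.\<close>

definition increasing_seq :: "(nat \<Rightarrow> nat) \<Rightarrow> bool" where
  "increasing_seq s \<longleftrightarrow> strict_mono s \<and> 0 < s 0"

definition upper_dimension :: "(nat \<Rightarrow> nat) \<Rightarrow> real" where
  "upper_dimension s =
     Inf {\<tau>. 0 \<le> \<tau> \<and> limsup (\<lambda>n. ereal (real (Suc n) / real (s n) powr \<tau>)) = 0}"

text \<open>The value at \<open>n = 0\<close>, where the join is over an empty family, is irrelevant to the limit.\<close>

definition entropy_generating ::
    "'a measure \<Rightarrow> ('a \<Rightarrow> 'a) \<Rightarrow> 'a set set \<Rightarrow> (nat \<Rightarrow> nat) \<Rightarrow> bool" where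
  "entropy_generating M T \<alpha> s \<longleftrightarrow> increasing_seq s \<and>
     0 < liminf (\<lambda>n. ereal (1 / real n * shannon_entropy M
            (common_refinement ((\<lambda>i. pullback_partition M T (s i) \<alpha>) ` {..<n}))))"

text \<open>The suprema below may be taken in the reals, since \<open>upper_dimension\<close> takes values in
  \<open>[0, 1]\<close> (see \<open>upper_dimension_bounds\<close>).\<close>

definition upper_entropy_dim_partition :: "'a measure \<Rightarrow> ('a \<Rightarrow> 'a) \<Rightarrow> 'a set set \<Rightarrow> real" where
  "upper_entropy_dim_partition M T \<alpha> =
     (if \<exists>s. entropy_generating M T \<alpha> s
      then Sup {upper_dimension s | s. entropy_generating M T \<alpha> s} else 0)"

definition upper_entropy_dim :: "'a measure \<Rightarrow> ('a \<Rightarrow> 'a) \<Rightarrow> real" where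
  "upper_entropy_dim M T = (SUP \<alpha>\<in>finite_partitions M. upper_entropy_dim_partition M T \<alpha>)"

definition Dims :: "'a measure \<Rightarrow> ('a \<Rightarrow> 'a) \<Rightarrow> real set" where
  "Dims M T = {upper_entropy_dim_partition M T {A, space M - A} | A.
     A \<in> sets M \<and> 0 < measure M A \<and> measure M A < 1}"

lemma upper_dimension_bounds:
  assumes "increasing_seq s"
  shows "0 \<le> upper_dimension s" "upper_dimension s \<le> 1"
proof -
  define I where "I = {\<tau>. 0 \<le> \<tau> \<and> limsup (\<lambda>n. ereal (real (Suc n) / real (s n) powr \<tau>)) = 0}"
  have s: "Suc n \<le> s n" for n
  proof (induction n)
    case 0
    then show ?case using assms by (simp add: increasing_seq_def)
  next
    case (Suc n)
    moreover have "s n < s (Suc n)"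
      using assms by (simp add: increasing_seq_def strict_mono_Suc_iff)
    ultimately show ?case by simp
  qed
  have mem: "\<tau> \<in> I" if "1 < \<tau>" for \<tau> :: real
  proof -
    have lim: "(\<lambda>n. real (Suc n) powr (1 - \<tau>)) \<longlonglongrightarrow> 0"
    proof (rule tendsto_neg_powr)
      show "1 - \<tau> < 0" using that by simp
      show "filterlim (\<lambda>n. real (Suc n)) at_top sequentially"
        by (rule filterlim_compose[OF filterlim_real_sequentially filterlim_Suc])
    qed
    have le: "real (Suc n) / real (s n) powr \<tau> \<le> real (Suc n) powr (1 - \<tau>)" for n
    proof -
      have "real (Suc n) powr \<tau> \<le> real (s n) powr \<tau>"
        using s[of n] that by (intro powr_mono2) auto
      then have "real (Suc n) / real (s n) powr \<tau> \<le> real (Suc n) / real (Suc n) powr \<tau>"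
        by (intro divide_left_mono mult_pos_pos) (use s[of n] in auto)
      also have "\<dots> = real (Suc n) powr (1 - \<tau>)"
        by (simp add: powr_diff)
      finally show ?thesis .
    qed
    have ge: "0 \<le> real (Suc n) / real (s n) powr \<tau>" for n
      by (rule divide_nonneg_nonneg) (rule of_nat_0_le_iff, rule powr_ge_zero)
    have "(\<lambda>n. real (Suc n) / real (s n) powr \<tau>) \<longlonglongrightarrow> 0"
      by (rule tendsto_sandwich[OF always_eventually always_eventually tendsto_const lim])
        (use le ge in blast)+
    then have "(\<lambda>n. ereal (real (Suc n) / real (s n) powr \<tau>)) \<longlonglongrightarrow> ereal 0"
      by (rule tendsto_ereal)
    then have "limsup (\<lambda>n. ereal (real (Suc n) / real (s n) powr \<tau>)) = ereal 0"
      by (rule lim_imp_Limsup[OF sequentially_bot])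
    moreover have "0 \<le> \<tau>" using that by linarith
    ultimately show ?thesis
      by (simp only: I_def mem_Collect_eq zero_ereal_def simp_thms)
  qed
  have "(2::real) \<in> I" by (rule mem) simp
  then have ne: "I \<noteq> {}" by blast
  have nonneg: "0 \<le> \<tau>" if "\<tau> \<in> I" for \<tau>
    using that by (simp only: I_def mem_Collect_eq)
  have eq: "upper_dimension s = Inf I" by (simp only: upper_dimension_def I_def)
  show "0 \<le> upper_dimension s"
    unfolding eq by (rule cInf_greatest[OF ne nonneg])
  have bdd: "bdd_below I" by (rule bdd_belowI[OF nonneg])
  show "upper_dimension s \<le> 1"
    unfolding eq by (rule dense_ge) (rule cInf_lower[OF mem bdd])
qed

section \<open>Joinings and disjointness\<close>

definition joining ::
    "'a measure \<Rightarrow> ('a \<Rightarrow> 'a) \<Rightarrow> 'b measure \<Rightarrow> ('b \<Rightarrow> 'b) \<Rightarrow> ('a \<times> 'b) measure \<Rightarrow> bool" where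
  "joining M T N S \<rho> \<longleftrightarrow> prob_space \<rho> \<and> sets \<rho> = sets (M \<Otimes>\<^sub>M N) \<and>
     distr \<rho> (M \<Otimes>\<^sub>M N) (map_prod T S) = \<rho> \<and>
     distr \<rho> M fst = M \<and> distr \<rho> N snd = N"

definition disjoint_systems ::
    "'a measure \<Rightarrow> ('a \<Rightarrow> 'a) \<Rightarrow> 'b measure \<Rightarrow> ('b \<Rightarrow> 'b) \<Rightarrow> bool" where
  "disjoint_systems M T N S \<longleftrightarrow> (\<forall>\<rho>. joining M T N S \<rho> \<longleftrightarrow> \<rho> = M \<Otimes>\<^sub>M N)"

end

theory Submission
  imports Defs
begin

text \<open>A joining \<open>\<rho>\<close> other than the product measure forces \<open>Y\<close> to carry part of the entropy of
  \<open>X\<close>: there are sets \<open>A\<close> in \<open>X\<close> and \<open>B\<close> in \<open>Y\<close>, with measures strictly between \<open>0\<close> and \<open>1\<close>,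
  such that every entropy generating sequence of \<open>{A, X - A}\<close> is an entropy generating
  sequence of \<open>{B, Y - B}\<close> (\<open>generating_transfer\<close>). Then the upper entropy dimension of \<open>{A, X
  - A}\<close>, a member of the dimension set of \<open>X\<close>, is at most that of \<open>{B, Y - B}\<close>, hence at most
  the upper metric entropy dimension of \<open>Y\<close>, against the hypothesis.

  To find the sets, let \<open>fiber_prob B x\<close> be the conditional probability of \<open>B\<close> given the point
  \<open>x\<close> of \<open>X\<close>. As \<open>\<rho>\<close> is not the product, \<open>fiber_prob B\<close> is not constant for some \<open>B\<close>, and
  \<open>A\<close> is the set where it exceeds a threshold \<open>t\<close> that is not an atom of its distribution
  (\<open>dependent_threshold\<close>). Since \<open>T\<close> is invertible, \<open>fiber_prob\<close> intertwines the two systems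
  (\<open>AE_fiber_prob_vimage\<close>).

  The law of large numbers links \<open>A\<close> and \<open>B\<close>. Take \<open>k\<close> copies of \<open>Y\<close>, conditionally
  independent over \<open>X\<close>. The fraction of copies that lie in \<open>B\<close> at time \<open>m\<close> is close to
  \<open>fiber_prob B ((T ^^ m) x)\<close>, so it tells, with small error probability, whether the orbit of
  \<open>x\<close> is in \<open>A\<close> at time \<open>m\<close>. Thus the \<open>A\<close>-name of \<open>x\<close> along any times \<open>s 0, ..., s (n - 1)\<close> is
  a function of \<open>k\<close> names with the law of the \<open>B\<close>-name, up to a small proportion of wrong
  letters, and its entropy is at most \<open>k\<close> times the entropy of the \<open>B\<close>-name plus a small
  multiple of \<open>n\<close> (\<open>word_entropy_le\<close>). Here \<open>k\<close> depends only on the desired precision.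

  The copies of \<open>Y\<close> never appear as a measurable system, which would require a disintegration
  of \<open>\<rho>\<close>. For fixed \<open>n\<close> there are finitely many names, and for almost every single \<open>x\<close>
  their conditional probabilities define a finite distribution. The entropy bound comes from
  comparing the law of the \<open>A\<close>-name with an explicit law (\<open>gibbs_inequality\<close>, \<open>guess_cost\<close>).\<close>

section \<open>Decoding noisy samples\<close>

lemma pmf_of_weights:
  fixes f :: "'w \<Rightarrow> real"
  assumes W: "finite W" and f: "\<And>w. w \<in> W \<Longrightarrow> 0 \<le> f w" "sum f W = 1"
  obtains p where "\<And>w. w \<in> W \<Longrightarrow> pmf p w = f w" "set_pmf p \<subseteq> W"
proof -
  let ?g = "\<lambda>w. if w \<in> W then f w else 0"
  have nonneg: "0 \<le> ?g w" for w using f by auto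
  have "(\<integral>\<^sup>+w. ennreal (?g w) \<partial>count_space UNIV) = (\<Sum>w\<in>W. ennreal (?g w))"
    by (rule nn_integral_count_space') (use W in auto)
  also have "\<dots> = ennreal (\<Sum>w\<in>W. ?g w)" by (rule sum_ennreal) (rule nonneg)
  also have "\<dots> = 1" using f(2) by simp
  finally have one: "(\<integral>\<^sup>+w. ennreal (?g w) \<partial>count_space UNIV) = 1" .
  show thesis
    by (rule that[of "embed_pmf ?g"])
      (auto simp: pmf_embed_pmf[OF nonneg one] set_embed_pmf[OF nonneg one] split: if_splits)
qed

text \<open>The tangent line inequality \<open>ln x \<le> x - 1\<close>, applied to \<open>Q u / P u\<close>. It turns an upper
  bound for an entropy into the construction of one good subprobability \<open>Q\<close>, and so replaces
  the calculus of conditional entropies in the whole proof.\<close>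

lemma gibbs_inequality:
  fixes P Q :: "'u \<Rightarrow> real"
  assumes "finite U"
    and P: "\<And>u. u \<in> U \<Longrightarrow> 0 \<le> P u" "sum P U = 1"
    and Q: "\<And>u. u \<in> U \<Longrightarrow> 0 < Q u" "sum Q U \<le> 1"
  shows "- (\<Sum>u\<in>U. P u * ln (P u)) \<le> (\<Sum>u\<in>U. P u * - ln (Q u))"
proof -
  have "P u * ln (Q u) - P u * ln (P u) \<le> Q u - P u" if u: "u \<in> U" for u
  proof (cases "P u = 0")
    case True
    then show ?thesis using Q(1)[OF u] by simp
  next
    case False
    then have pos: "0 < P u" using P(1)[OF u] by simp
    have "ln (Q u / P u) \<le> Q u / P u - 1"
      using pos Q(1)[OF u] by (intro ln_le_minus_one) simp
    then have "P u * ln (Q u / P u) \<le> P u * (Q u / P u - 1)"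
      using pos by simp
    then show ?thesis
      using pos Q(1)[OF u] by (simp add: ln_div right_diff_distrib)
  qed
  then have "(\<Sum>u\<in>U. P u * ln (Q u) - P u * ln (P u)) \<le> (\<Sum>u\<in>U. Q u - P u)"
    by (rule sum_mono)
  then show ?thesis
    using P(2) Q(2) by (simp add: sum_subtractf sum_negf)
qed

text \<open>The probability that the word \<open>v\<close>, with each of its \<open>n\<close> letters flipped independently with
  probability \<open>\<delta>\<close>, becomes the word \<open>u\<close>. A binary word is the set of the positions of
  its ones.\<close>

definition noise :: "real \<Rightarrow> nat \<Rightarrow> nat set \<Rightarrow> nat set \<Rightarrow> real" where
  "noise \<delta> n u v = (\<Prod>i<n. if i \<in> u \<longleftrightarrow> i \<in> v then 1 - \<delta> else \<delta>)"

lemma noise_pos: "0 < \<delta> \<Longrightarrow> \<delta> < 1 \<Longrightarrow> 0 < noise \<delta> n u v"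
  unfolding noise_def by (intro prod_pos) auto

lemma noise_le_1: "0 < \<delta> \<Longrightarrow> \<delta> < 1 \<Longrightarrow> noise \<delta> n u v \<le> 1"
  unfolding noise_def by (intro prod_le_1) auto

text \<open>Expanding \<open>\<Prod>i<n. ((1 - \<delta>) + \<delta>)\<close> over the subsets of \<open>{..<n}\<close> gives the
  total mass.\<close>

lemma sum_noise: "(\<Sum>u\<in>Pow {..<n}. noise \<delta> n u v) = 1"
proof -
  let ?f = "\<lambda>i. if i \<in> v then 1 - \<delta> else \<delta>" and ?g = "\<lambda>i. if i \<in> v then \<delta> else 1 - \<delta>"
  have "noise \<delta> n u v = prod ?f u * prod ?g ({..<n} - u)" if "u \<in> Pow {..<n}" for u
  proof -
    have u: "u \<subseteq> {..<n}" using that by simp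
    have "noise \<delta> n u v = (\<Prod>i<n. if i \<in> u then ?f i else ?g i)"
      unfolding noise_def by (intro prod.cong) auto
    also have "\<dots> = prod ?f ({..<n} \<inter> u) * prod ?g ({..<n} \<inter> - u)"
      using prod.If_cases[of "{..<n}" "\<lambda>i. i \<in> u" ?f ?g] by simp
    finally show ?thesis using u by (simp add: Int_absorb1 Diff_eq)
  qed
  then have "(\<Sum>u\<in>Pow {..<n}. noise \<delta> n u v) =
      (\<Sum>u\<in>Pow {..<n}. prod ?f u * prod ?g ({..<n} - u))"
    by (rule sum.cong[OF refl])
  also have "\<dots> = (\<Prod>i<n. ?f i + ?g i)" by (rule prod_add[symmetric]) simp
  also have "\<dots> = 1" by (intro prod.neutral) auto
  finally show ?thesis .
qed

definition decode :: "nat \<Rightarrow> real \<Rightarrow> nat \<Rightarrow> (nat \<Rightarrow> nat set) \<Rightarrow> nat set" where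
  "decode k t n w = {i \<in> {..<n}. t < real (card {j \<in> {..<k}. i \<in> w j}) / real k}"

text \<open>The law of the output when \<open>k\<close> independent words with law \<open>\<nu>\<close> are decoded letterwise and
  the result is corrupted by noise. The noise makes every word possible, so that a wrong
  letter costs \<open>- ln \<delta>\<close> instead of infinity. This is the comparison law for the Gibbs
  inequality.\<close>

definition guess :: "nat set pmf \<Rightarrow> real \<Rightarrow> nat \<Rightarrow> real \<Rightarrow> nat \<Rightarrow> nat set \<Rightarrow> real" where
  "guess \<nu> \<delta> k t n u =
     measure_pmf.expectation (Pi_pmf {..<k} {} (\<lambda>_. \<nu>)) (\<lambda>w. noise \<delta> n u (decode k t n w))"

lemma integrable_noise:
  assumes "0 < \<delta>" "\<delta> < 1"
  shows "integrable (measure_pmf p) (\<lambda>w. noise \<delta> n u (f w))"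
  by (rule measure_pmf.integrable_const_bound[where B = 1])
    (auto intro!: AE_I2 simp: abs_of_pos noise_pos noise_le_1 assms)

text \<open>A mixture dominates each of its terms.\<close>

lemma guess_ge:
  assumes "0 < \<delta>" "\<delta> < 1"
  shows "pmf (Pi_pmf {..<k} {} (\<lambda>_. \<nu>)) w * noise \<delta> n u (decode k t n w) \<le> guess \<nu> \<delta> k t n u"
proof -
  let ?p = "Pi_pmf {..<k} {} (\<lambda>_. \<nu>)" and ?f = "\<lambda>w. noise \<delta> n u (decode k t n w)"
  have "pmf ?p w * ?f w = measure_pmf.expectation ?p (\<lambda>w'. ?f w' * indicator {w} w')"
    by (subst integral_measure_pmf_real[of "{w}"]) (auto split: split_indicator_asm)
  also have "\<dots> \<le> measure_pmf.expectation ?p ?f"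
  proof (rule integral_mono)
    show "integrable ?p (\<lambda>w'. ?f w' * indicator {w} w')"
      by (intro integrable_real_mult_indicator integrable_noise assms) auto
    show "?f w' * indicator {w} w' \<le> ?f w'" for w'
      using noise_pos[OF assms, of n u "decode k t n w'"] by (auto split: split_indicator)
  qed (rule integrable_noise[OF assms])
  finally show ?thesis by (simp add: guess_def)
qed

lemma guess_pos:
  assumes "0 < \<delta>" "\<delta> < 1"
  shows "0 < guess \<nu> \<delta> k t n u"
proof -
  obtain w where "w \<in> set_pmf (Pi_pmf {..<k} {} (\<lambda>_. \<nu>))"
    using set_pmf_not_empty[of "Pi_pmf {..<k} {} (\<lambda>_. \<nu>)"] by blast
  then show ?thesis
    by (intro less_le_trans[OF _ guess_ge[OF assms, where w = w]] mult_pos_pos pmf_positive noise_pos assms)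
qed

lemma sum_guess:
  assumes "0 < \<delta>" "\<delta> < 1"
  shows "(\<Sum>u\<in>Pow {..<n}. guess \<nu> \<delta> k t n u) = 1"
  unfolding guess_def
  by (subst Bochner_Integration.integral_sum[symmetric]) (auto simp: sum_noise intro!: integrable_noise assms)

text \<open>The \<open>k\<close> letters in position \<open>i\<close> are independent coin flips, so Hoeffding's bound for the
  binomial distribution becomes available.\<close>

lemma sample_frequency:
  fixes \<rho> :: "nat set pmf" and i :: nat
  defines "q \<equiv> measure_pmf.prob \<rho> {w. i \<in> w}"
  shows "map_pmf (\<lambda>w. card {j \<in> {..<k}. i \<in> w j}) (Pi_pmf {..<k} {} (\<lambda>_. \<rho>)) = binomial_pmf k q"
proof -
  have q: "q \<in> {0..1}" by (simp add: q_def)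
  have b: "map_pmf (\<lambda>w. i \<in> w) \<rho> = bernoulli_pmf q"
  proof (rule pmf_eqI)
    fix b
    have "- {w. i \<in> w} = {w. i \<notin> w}" by auto
    then have "measure_pmf.prob \<rho> {w. i \<notin> w} = 1 - q"
      using measure_pmf.prob_compl[of "{w. i \<in> w}" \<rho>] by (simp add: q_def Compl_eq_Diff_UNIV)
    then show "pmf (map_pmf (\<lambda>w. i \<in> w) \<rho>) b = pmf (bernoulli_pmf q) b"
      using q by (cases b) (simp_all add: pmf_map vimage_def q_def)
  qed
  have "binomial_pmf k q =
      map_pmf (\<lambda>f. card {j\<in>{..<k}. f j}) (Pi_pmf {..<k} False (\<lambda>_. map_pmf (\<lambda>w. i \<in> w) \<rho>))"
    unfolding b by (rule binomial_pmf_altdef') (use q in auto)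
  also have "Pi_pmf {..<k} False (\<lambda>_. map_pmf (\<lambda>w. i \<in> w) \<rho>) =
      map_pmf (\<lambda>h. (\<lambda>w. i \<in> w) \<circ> h) (Pi_pmf {..<k} {} (\<lambda>_. \<rho>))"
    by (rule Pi_pmf_map) auto
  finally show ?thesis by (simp add: map_pmf_comp)
qed

text \<open>If \<open>q\<close> is at distance more than \<open>\<epsilon>\<close> from the threshold, a wrong decision needs a
  sample frequency that deviates from \<open>q\<close> by at least \<open>\<epsilon>\<close>, which Hoeffding's
  inequality makes unlikely. If \<open>q\<close> is closer to \<open>t\<close>, the trivial bound \<open>1\<close> has to do.\<close>

lemma decode_error:
  fixes \<rho> :: "nat set pmf" and i :: nat
  defines "q \<equiv> measure_pmf.prob \<rho> {w. i \<in> w}"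
  assumes "0 < k" "0 \<le> \<epsilon>" "i < n"
  shows "measure_pmf.prob (Pi_pmf {..<k} {} (\<lambda>_. \<rho>)) {w. (t < q) \<noteq> (i \<in> decode k t n w)}
    \<le> 2 * exp (- 2 * real k * \<epsilon>\<^sup>2) + (if \<bar>q - t\<bar> \<le> \<epsilon> then 1 else 0)"
proof (cases "\<bar>q - t\<bar> \<le> \<epsilon>")
  case True
  then show ?thesis
    by (simp add: add.commute add_increasing2)
next
  case False
  let ?R = "Pi_pmf {..<k} {} (\<lambda>_. \<rho>)" and ?c = "\<lambda>w. card {j \<in> {..<k}. i \<in> w j}"
  interpret binomial_distribution k q by unfold_locales (simp add: q_def)
  have "measure_pmf.prob ?R {w. (t < q) \<noteq> (i \<in> decode k t n w)}
      \<le> measure_pmf.prob ?R (?c -` {x. \<bar>real x / real k - q\<bar> \<ge> \<epsilon>})"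
    using False \<open>i < n\<close> by (intro measure_pmf.finite_measure_mono) (auto simp: decode_def)
  also have "\<dots> = measure_pmf.prob (map_pmf ?c ?R) {x. \<bar>real x / real k - q\<bar> \<ge> \<epsilon>}"
    by simp
  also have "map_pmf ?c ?R = binomial_pmf k q"
    unfolding q_def by (rule sample_frequency)
  also have "measure_pmf.prob (binomial_pmf k q) {x. \<bar>real x / real k - q\<bar> \<ge> \<epsilon>}
      \<le> 2 * exp (- 2 * real k * \<epsilon>\<^sup>2)"
    using prob_abs_ge'[of \<epsilon>] assms by simp
  finally show ?thesis using False by simp
qed

text \<open>The pointwise heart of the argument. For one point of \<open>X\<close>, \<open>\<rho>\<close> is the conditional law
  of the \<open>Y\<close>-word and \<open>u\<close> is the \<open>X\<close>-word, read off by comparing the one-letter probabilities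
  \<open>q i\<close> with \<open>t\<close>. Each choice of words \<open>w\<close> bounds \<open>guess\<close> from below by a single term of the
  mixture; averaging the resulting costs over \<open>k\<close> independent words with law \<open>\<rho>\<close> gives
  \<open>k\<close> times a cross entropy, plus the price of the decoding errors.\<close>

lemma guess_cost:
  fixes \<rho> \<nu> :: "nat set pmf"
  defines "q \<equiv> \<lambda>i. measure_pmf.prob \<rho> {w. i \<in> w}"
  assumes \<delta>: "0 < \<delta>" "\<delta> < 1" and "0 < k" "0 \<le> \<epsilon>"
    and fin: "finite (set_pmf \<rho>)" and sub: "set_pmf \<rho> \<subseteq> set_pmf \<nu>"
    and u: "\<And>i. i < n \<Longrightarrow> i \<in> u \<longleftrightarrow> t < q i"
  shows "- ln (guess \<nu> \<delta> k t n u) \<le>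
     real k * measure_pmf.expectation \<rho> (\<lambda>v. - ln (pmf \<nu> v)) + real n * - ln (1 - \<delta>)
     + - ln \<delta> * (\<Sum>i<n. 2 * exp (- 2 * real k * \<epsilon>\<^sup>2) + (if \<bar>q i - t\<bar> \<le> \<epsilon> then 1 else 0))"
proof -
  let ?R = "Pi_pmf {..<k} {} (\<lambda>_. \<rho>)" and ?D = "decode k t n"
  let ?h = "\<lambda>v. - ln (pmf \<nu> v)"
  let ?err = "\<lambda>i. {w. (t < q i) \<noteq> (i \<in> ?D w)}"
  let ?bound = "\<lambda>w. (\<Sum>j<k. ?h (w j)) + (real n * - ln (1 - \<delta>) + - ln \<delta> * (\<Sum>i<n. indicator (?err i) w))"
  have R: "set_pmf ?R = PiE_dflt {..<k} {} (\<lambda>_. set_pmf \<rho>)"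
    by (simp add: set_Pi_pmf o_def)
  then have finR: "finite (set_pmf ?R)" using fin by (auto intro!: finite_PiE_dflt)
  have cost: "- ln (guess \<nu> \<delta> k t n u) \<le> ?bound w" if w: "w \<in> set_pmf ?R" for w
  proof -
    have wj: "w j \<in> set_pmf \<nu>" if "j < k" for j
      using w that sub unfolding R by (auto simp: PiE_dflt_def)
    have pw: "pmf (Pi_pmf {..<k} {} (\<lambda>_. \<nu>)) w = (\<Prod>j<k. pmf \<nu> (w j))"
      using w unfolding R by (subst pmf_Pi) (auto simp: PiE_dflt_def)
    have pos: "0 < (\<Prod>j<k. pmf \<nu> (w j))"
      by (intro prod_pos) (auto intro!: pmf_positive wj)
    have ln_noise: "ln (noise \<delta> n u (?D w)) = (\<Sum>i<n. ln (if i \<in> u \<longleftrightarrow> i \<in> ?D w then 1 - \<delta> else \<delta>))"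
      unfolding noise_def by (rule ln_prod) (use \<delta> in auto)
    have "- ln (noise \<delta> n u (?D w)) \<le> (\<Sum>i<n. - ln (1 - \<delta>) + - ln \<delta> * indicator (?err i) w)"
      unfolding ln_noise sum_negf[symmetric]
      by (rule sum_mono) (use \<delta> u in \<open>auto split: split_indicator simp: less_imp_le\<close>)
    then have noise: "- ln (noise \<delta> n u (?D w))
        \<le> real n * - ln (1 - \<delta>) + - ln \<delta> * (\<Sum>i<n. indicator (?err i) w)"
      by (simp add: sum.distrib sum_distrib_left sum_subtractf sum_negf)
    have "- ln (guess \<nu> \<delta> k t n u) \<le> - ln ((\<Prod>j<k. pmf \<nu> (w j)) * noise \<delta> n u (?D w))"
      using guess_ge[OF \<delta>, where k = k and w = w and \<nu> = \<nu> and u = u and n = n and t = t] guess_pos[OF \<delta>] pos noise_pos[OF \<delta>]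
      by (simp add: pw)
    also have "\<dots> = (\<Sum>j<k. ?h (w j)) - ln (noise \<delta> n u (?D w))"
    proof -
      have "ln (\<Prod>j<k. pmf \<nu> (w j)) = (\<Sum>j<k. ln (pmf \<nu> (w j)))"
        by (rule ln_prod) (use wj in \<open>auto simp: pmf_eq_0_set_pmf\<close>)
      then show ?thesis
        by (simp only: ln_mult_pos[OF pos noise_pos[OF \<delta>]] sum_negf)
    qed
    finally show ?thesis using noise by simp
  qed
  have int: "integrable (measure_pmf ?R) f" for f :: "(nat \<Rightarrow> nat set) \<Rightarrow> real"
    by (rule integrable_measure_pmf_finite[OF finR])
  have int\<rho>: "integrable (measure_pmf \<rho>) f" for f :: "nat set \<Rightarrow> real"
    by (rule integrable_measure_pmf_finite[OF fin])
  have "- ln (guess \<nu> \<delta> k t n u) = measure_pmf.expectation ?R (\<lambda>w. - ln (guess \<nu> \<delta> k t n u))"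
    by simp
  also have "\<dots> \<le> measure_pmf.expectation ?R ?bound"
    by (rule integral_mono_AE[OF int int]) (use cost in \<open>simp add: AE_measure_pmf_iff\<close>)
  also have "\<dots> = measure_pmf.expectation ?R (\<lambda>w. \<Sum>j<k. ?h (w j))
      + (measure_pmf.expectation ?R (\<lambda>w. real n * - ln (1 - \<delta>))
      + measure_pmf.expectation ?R (\<lambda>w. - ln \<delta> * (\<Sum>i<n. indicator (?err i) w)))"
    by (simp only: Bochner_Integration.integral_add[OF int int])
  also have "measure_pmf.expectation ?R (\<lambda>w. \<Sum>j<k. ?h (w j))
      = real k * measure_pmf.expectation \<rho> ?h"
    by (subst expectation_sum_Pi_pmf) (use int\<rho> in auto)
  also have "measure_pmf.expectation ?R (\<lambda>w. real n * - ln (1 - \<delta>)) = real n * - ln (1 - \<delta>)"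
    by simp
  also have "measure_pmf.expectation ?R (\<lambda>w. - ln \<delta> * (\<Sum>i<n. indicator (?err i) w))
      = - ln \<delta> * (\<Sum>i<n. measure_pmf.prob ?R (?err i))"
    by (simp add: int Bochner_Integration.integral_sum)
  also have "(\<Sum>i<n. measure_pmf.prob ?R (?err i))
      \<le> (\<Sum>i<n. 2 * exp (- 2 * real k * \<epsilon>\<^sup>2) + (if \<bar>q i - t\<bar> \<le> \<epsilon> then 1 else 0))"
    unfolding q_def by (rule sum_mono, rule decode_error) (use assms in auto)
  then have "- ln \<delta> * (\<Sum>i<n. measure_pmf.prob ?R (?err i)) \<le>
     - ln \<delta> * (\<Sum>i<n. 2 * exp (- 2 * real k * \<epsilon>\<^sup>2) + (if \<bar>q i - t\<bar> \<le> \<epsilon> then 1 else 0))"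
    by (rule mult_left_mono) (use \<delta> in \<open>simp add: less_imp_le\<close>)
  finally show ?thesis by simp
qed

text \<open>The order of the choices matters: the noise \<open>\<delta>\<close> fixes the price \<open>- ln \<delta>\<close> of an
  error; then the window \<open>\<epsilon>\<close> is chosen small, which works because \<open>t\<close> is not an atom;
  and then the number \<open>k\<close> of copies large.\<close>

lemma exists_accuracy:
  fixes \<eta> :: real
  assumes fin: "finite_measure M" and f [measurable]: "f \<in> borel_measurable M"
    and atom: "measure M {x \<in> space M. f x = t} = 0" and "0 < \<eta>"
  obtains \<delta> \<epsilon> k where "0 < \<delta>" "\<delta> < 1" "0 < k" "0 \<le> \<epsilon>"
    "- ln (1 - \<delta>) + - ln \<delta> * (2 * exp (- 2 * real k * \<epsilon>\<^sup>2)
       + measure M {x \<in> space M. \<bar>f x - t\<bar> \<le> \<epsilon>}) < \<eta>"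
proof -
  interpret finite_measure M by fact
  \<comment> \<open>This makes \<open>- ln (1 - \<delta>)\<close> at most \<open>\<eta> / 4\<close>.\<close>
  define \<delta> where "\<delta> = min (1 / 2) (1 - exp (- \<eta> / 4))"
  have \<delta>: "0 < \<delta>" "\<delta> < 1" using \<open>0 < \<eta>\<close> by (auto simp: \<delta>_def)
  have "exp (- \<eta> / 4) \<le> 1 - \<delta>" by (simp add: \<delta>_def min_def)
  then have "- \<eta> / 4 \<le> ln (1 - \<delta>)" using \<delta> by (subst ln_ge_iff) auto
  then have first: "- ln (1 - \<delta>) \<le> \<eta> / 4" by simp
  define L where "L = - ln \<delta>"
  have L: "0 < L" using \<delta> by (simp add: L_def)
  define Z where "Z j = {x \<in> space M. \<bar>f x - t\<bar> \<le> 1 / real (Suc j)}" for j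
  have "(\<lambda>j. measure M (Z j)) \<longlonglongrightarrow> measure M (\<Inter>j. Z j)"
  proof (rule finite_Lim_measure_decseq)
    show "range Z \<subseteq> sets M" unfolding Z_def by auto
    show "decseq Z"
    proof (rule decseq_SucI)
      fix j
      have "1 / real (Suc (Suc j)) \<le> 1 / real (Suc j)" by (simp add: frac_le)
      then show "Z (Suc j) \<le> Z j" by (auto simp: Z_def)
    qed
  qed
  also have "(\<Inter>j. Z j) = {x \<in> space M. f x = t}"
  proof (intro equalityI subsetI)
    fix x assume x: "x \<in> (\<Inter>j. Z j)"
    have "\<bar>f x - t\<bar> \<le> 0"
    proof (rule ccontr)
      assume "\<not> ?thesis"
      then obtain j where "1 / real (Suc j) < \<bar>f x - t\<bar>"
        using nat_approx_posE[of "\<bar>f x - t\<bar>"] by auto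
      moreover have "x \<in> Z j" using x by blast
      ultimately show False by (simp add: Z_def)
    qed
    then show "x \<in> {x \<in> space M. f x = t}" using x by (auto simp: Z_def)
  qed (auto simp: Z_def)
  finally have lim: "(\<lambda>j. measure M (Z j)) \<longlonglongrightarrow> 0" using atom by simp
  have "eventually (\<lambda>j. measure M (Z j) < \<eta> / (4 * L)) sequentially"
    by (rule order_tendstoD(2)[OF lim]) (use \<open>0 < \<eta>\<close> L in simp)
  then obtain j where j: "measure M (Z j) < \<eta> / (4 * L)"
    by (auto simp: eventually_sequentially)
  define \<epsilon> where "\<epsilon> = 1 / real (Suc j)"
  have \<epsilon>: "0 < \<epsilon>" by (simp add: \<epsilon>_def)
  have "(\<lambda>k. 2 * exp (- 2 * \<epsilon>\<^sup>2) ^ k) \<longlonglongrightarrow> 2 * 0"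
    using \<epsilon> by (intro tendsto_mult_left LIMSEQ_realpow_zero) auto
  then have "(\<lambda>k. 2 * exp (- 2 * real k * \<epsilon>\<^sup>2)) \<longlonglongrightarrow> 0"
    by (simp add: exp_of_nat_mult[symmetric] mult_ac)
  then have "eventually (\<lambda>k. 2 * exp (- 2 * real k * \<epsilon>\<^sup>2) < \<eta> / (4 * L)) sequentially"
    by (rule order_tendstoD(2)) (use \<open>0 < \<eta>\<close> L in simp)
  then have "eventually (\<lambda>k. 0 < k \<and> 2 * exp (- 2 * real k * \<epsilon>\<^sup>2) < \<eta> / (4 * L)) sequentially"
    using eventually_gt_at_top[of "0::nat"] by eventually_elim simp
  then obtain k where k: "0 < k" "2 * exp (- 2 * real k * \<epsilon>\<^sup>2) < \<eta> / (4 * L)"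
    using eventually_happens'[OF sequentially_bot] by blast
  have "L * (2 * exp (- 2 * real k * \<epsilon>\<^sup>2) + measure M (Z j)) < L * (\<eta> / (4 * L) + \<eta> / (4 * L))"
    by (intro mult_strict_left_mono add_strict_mono j k L)
  also have "\<dots> = \<eta> / 2" using L by (simp add: field_simps)
  finally have "- ln (1 - \<delta>) + L * (2 * exp (- 2 * real k * \<epsilon>\<^sup>2) + measure M (Z j)) < \<eta>"
    using first \<open>0 < \<eta>\<close> by simp
  then show thesis
    using that[OF \<delta> k(1), of \<epsilon>] \<epsilon> by (simp add: L_def Z_def \<epsilon>_def)
qed

section \<open>Names of orbits along a sequence of times\<close>

text \<open>The partitions are indexed by the set of their values, so equal partitions at different
  positions count once, and empty cells are removed; neither affects the cells of the join,
  which are the level sets of the name map \<open>x \<mapsto> {i. x \<in> E i}\<close>. For \<open>n = 0\<close> the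
  join would be \<open>{UNIV}\<close>.\<close>

lemma common_refinement_two_cells:
  fixes X :: "'a set"
  assumes "0 < n" and E: "\<And>i. i < n \<Longrightarrow> E i \<subseteq> X"
  shows "common_refinement ((\<lambda>i. {E i, X - E i} - {{}}) ` {..<n}) =
     (\<lambda>u. {x \<in> X. {i \<in> {..<n}. x \<in> E i} = u}) ` Pow {..<n} - {{}}"
    (is "common_refinement (?P ` {..<n}) = ?c ` _ - _")
proof -
  let ?w = "\<lambda>x. {i \<in> {..<n}. x \<in> E i}"
  \<comment> \<open>A point of a cell determines the chosen member of each two-cell partition, hence the cell.\<close>
  have cell: "x \<in> X \<and> C = ?c (?w x)" if C: "C \<in> common_refinement (?P ` {..<n})" and x: "x \<in> C" for C x
  proof -
    obtain f where f: "f \<in> (\<Pi> Q\<in>?P ` {..<n}. Q)" and Cf: "C = \<Inter> (f ` ?P ` {..<n})"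
      using C unfolding common_refinement by blast
    have xf: "x \<in> f (?P i)" "f (?P i) \<in> ?P i" if "i < n" for i
    proof -
      have Pi: "?P i \<in> ?P ` {..<n}" using that by (intro imageI) simp
      from f Pi show "f (?P i) \<in> ?P i" by (rule Pi_mem)
      from Pi have "f (?P i) \<in> f ` ?P ` {..<n}" by (rule imageI)
      with x show "x \<in> f (?P i)" unfolding Cf by (rule InterD)
    qed
    have eq: "f (?P i) = (if x \<in> E i then E i else X - E i)" if "i < n" for i
      using xf[OF that] by fastforce
    have "C = (\<Inter>i<n. if x \<in> E i then E i else X - E i)"
      unfolding Cf image_image by (rule INF_cong) (simp_all only: eq lessThan_iff)
    moreover have "x \<in> X"
      using xf[OF \<open>0 < n\<close>] E[OF \<open>0 < n\<close>] by auto
    moreover have "(\<Inter>i<n. if x \<in> E i then E i else X - E i) = ?c (?w x)"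
    proof (intro equalityI subsetI)
      fix y assume y: "y \<in> (\<Inter>i<n. if x \<in> E i then E i else X - E i)"
      then have "y \<in> (if x \<in> E i then E i else X - E i)" if "i < n" for i
        using that by blast
      then have *: "y \<in> X \<and> (y \<in> E i \<longleftrightarrow> x \<in> E i)" if "i < n" for i
        using that E[OF that] by (cases "x \<in> E i") force+
      then have "?w y = ?w x" by (intro Collect_cong conj_cong refl) (simp add: *)
      moreover have "y \<in> X" using *[OF \<open>0 < n\<close>] by simp
      ultimately show "y \<in> ?c (?w x)" by simp
    next
      fix y assume y: "y \<in> ?c (?w x)"
      have "y \<in> (if x \<in> E i then E i else X - E i)" if "i < n" for i
      proof -
        have "y \<in> X" "?w y = ?w x" using y by simp_all
        moreover have "i \<in> ?w y \<longleftrightarrow> y \<in> E i" "i \<in> ?w x \<longleftrightarrow> x \<in> E i" using that by simp_all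
        ultimately show ?thesis by simp
      qed
      then show "y \<in> (\<Inter>i<n. if x \<in> E i then E i else X - E i)" by blast
    qed
    ultimately show ?thesis by simp
  qed
  have cover: "\<Union> (common_refinement (?P ` {..<n})) = X"
  proof -
    have "\<Union> (?P i) = X" if "i < n" for i
    proof -
      have "\<Union> (A - {{}}) = \<Union> A" for A :: "'a set set" by auto
      then have "\<Union> (?P i) = \<Union> {E i, X - E i}" .
      then show ?thesis using E[OF that] by auto
    qed
    then have "(\<Inter>i<n. \<Union> (?P i)) = (\<Inter>i<n. X)" by (intro INF_cong refl) (simp only: lessThan_iff)
    also have "\<dots> = X" using \<open>0 < n\<close> by (intro INF_const) auto
    finally show ?thesis unfolding Union_common_refinement image_image .
  qed
  show ?thesis
  proof (intro equalityI subsetI)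
    fix C assume C: "C \<in> common_refinement (?P ` {..<n})"
    then have "C \<noteq> {}" by (simp add: common_refinement_def)
    then obtain x where x: "x \<in> C" by blast
    have "C = ?c (?w x)" "?w x \<in> Pow {..<n}" using cell[OF C x] by (simp, blast)
    then have "C \<in> ?c ` Pow {..<n}" by (rule image_eqI)
    then show "C \<in> ?c ` Pow {..<n} - {{}}" using x by blast
  next
    fix C assume "C \<in> ?c ` Pow {..<n} - {{}}"
    then have im: "C \<in> ?c ` Pow {..<n}" and "C \<noteq> {}" by simp_all
    from im obtain u where u: "C = ?c u" by (elim imageE)
    from \<open>C \<noteq> {}\<close> obtain x where x: "x \<in> C" by blast
    have "x \<in> X" "C = ?c (?w x)" using u x by simp_all
    from \<open>x \<in> X\<close> have "x \<in> \<Union> (common_refinement (?P ` {..<n}))" by (simp only: cover)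
    then obtain D where D: "D \<in> common_refinement (?P ` {..<n})" "x \<in> D" by (rule UnionE)
    with cell[OF D] \<open>C = ?c (?w x)\<close> show "C \<in> common_refinement (?P ` {..<n})" by simp
  qed
qed

text \<open>The name of \<open>x\<close> for the partition \<open>{A, space M - A}\<close> along the times \<open>s 0, ..., s (n - 1)\<close>.\<close>

definition word :: "('a \<Rightarrow> 'a) \<Rightarrow> 'a set \<Rightarrow> (nat \<Rightarrow> nat) \<Rightarrow> nat \<Rightarrow> 'a \<Rightarrow> nat set" where
  "word T A s n x = {i \<in> {..<n}. (T ^^ s i) x \<in> A}"

definition cell :: "'a measure \<Rightarrow> ('a \<Rightarrow> 'a) \<Rightarrow> 'a set \<Rightarrow> (nat \<Rightarrow> nat) \<Rightarrow> nat \<Rightarrow> nat set \<Rightarrow> 'a set" where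
  "cell M T A s n u = {x \<in> space M. word T A s n x = u}"

definition word_entropy :: "'a measure \<Rightarrow> ('a \<Rightarrow> 'a) \<Rightarrow> 'a set \<Rightarrow> (nat \<Rightarrow> nat) \<Rightarrow> nat \<Rightarrow> real" where
  "word_entropy M T A s n =
     - (\<Sum>u\<in>Pow {..<n}. measure M (cell M T A s n u) * ln (measure M (cell M T A s n u)))"

lemma word_subset: "word T A s n x \<subseteq> {..<n}"
  by (auto simp: word_def)

context mds
begin

lemma measurable_pow: "T ^^ k \<in> M \<rightarrow>\<^sub>M M"
proof (induction k)
  case (Suc k)
  then show ?case unfolding funpow.simps by (rule measurable_comp) (rule measurable_T)
qed (simp add: id_def)

lemma pow_in_space: "x \<in> space M \<Longrightarrow> (T ^^ k) x \<in> space M"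
  using measurable_pow[of k] by (rule measurable_space)

lemma preserves_pow: "distr M M (T ^^ k) = M"
proof (induction k)
  case (Suc k)
  have "distr M M (T ^^ Suc k) = distr (distr M M T) M (T ^^ k)"
    by (simp only: distr_distr[OF measurable_pow measurable_T] funpow_Suc_right)
  then show ?case by (simp only: preserves_T Suc)
qed (simp add: distr_id[unfolded id_def])

lemma cell_sets:
  assumes [measurable]: "A \<in> sets M"
  shows "cell M T A s n u \<in> sets M"
proof (cases "u \<subseteq> {..<n}")
  case True
  note measurable_pow[measurable]
  have "cell M T A s n u = {x \<in> space M. \<forall>i\<in>{..<n}. (T ^^ s i) x \<in> A \<longleftrightarrow> i \<in> u}"
    using True by (auto simp: cell_def word_def)
  also have "\<dots> \<in> sets M" by measurable
  finally show ?thesis .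
next
  case False
  then have "cell M T A s n u = {}" using word_subset[of T A s n] by (auto simp: cell_def)
  then show ?thesis by simp
qed

lemma sum_measure_cells:
  assumes "A \<in> sets M"
  shows "(\<Sum>u\<in>Pow {..<n}. measure M (cell M T A s n u)) = 1"
proof -
  have "(\<Sum>u\<in>Pow {..<n}. measure M (cell M T A s n u)) = measure M (\<Union>u\<in>Pow {..<n}. cell M T A s n u)"
    by (rule finite_measure_finite_Union[symmetric])
      (use cell_sets[OF assms] in \<open>auto simp: disjoint_family_on_def cell_def\<close>)
  also have "(\<Union>u\<in>Pow {..<n}. cell M T A s n u) = space M"
    using word_subset by (fastforce simp: cell_def)
  finally show ?thesis by (simp add: prob_space)
qed

lemma shannon_entropy_eq_word_entropy:
  assumes A: "A \<subseteq> space M" and "0 < n"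
  shows "shannon_entropy M (common_refinement
      ((\<lambda>i. pullback_partition M T (s i) {A, space M - A}) ` {..<n})) = word_entropy M T A s n"
proof -
  let ?E = "\<lambda>i. (T ^^ s i) -` A \<inter> space M" and ?c = "cell M T A s n"
  have "pullback_partition M T (s i) {A, space M - A} = {?E i, space M - ?E i} - {{}}" for i
  proof -
    have "(T ^^ s i) -` (space M - A) \<inter> space M = space M - ?E i"
      using pow_in_space by auto
    then show ?thesis unfolding pullback_partition_def by simp
  qed
  then have "common_refinement ((\<lambda>i. pullback_partition M T (s i) {A, space M - A}) ` {..<n})
      = (\<lambda>u. {x \<in> space M. {i \<in> {..<n}. x \<in> ?E i} = u}) ` Pow {..<n} - {{}}"
    using common_refinement_two_cells[OF \<open>0 < n\<close>, of ?E "space M"] by simp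
  also have "(\<lambda>u. {x \<in> space M. {i \<in> {..<n}. x \<in> ?E i} = u}) = ?c"
    by (auto simp: cell_def word_def fun_eq_iff)
  also have "?c ` Pow {..<n} - {{}} = ?c ` {u \<in> Pow {..<n}. ?c u \<noteq> {}}"
    by blast
  finally have eq: "common_refinement ((\<lambda>i. pullback_partition M T (s i) {A, space M - A}) ` {..<n})
     = ?c ` {u \<in> Pow {..<n}. ?c u \<noteq> {}}" .
  have inj: "inj_on ?c {u \<in> Pow {..<n}. ?c u \<noteq> {}}"
    by (rule inj_onI) (auto simp: cell_def)
  have "(\<Sum>u\<in>{u \<in> Pow {..<n}. ?c u \<noteq> {}}. measure M (?c u) * ln (measure M (?c u)))
      = (\<Sum>u\<in>Pow {..<n}. measure M (?c u) * ln (measure M (?c u)))"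
    by (rule sum.mono_neutral_left) auto
  then show ?thesis
    unfolding shannon_entropy_def word_entropy_def eq sum.reindex[OF inj] by simp
qed

end

lemma entropy_generating_iff_word_entropy:
  assumes "mds M T" "A \<in> sets M"
  shows "entropy_generating M T {A, space M - A} s \<longleftrightarrow>
    increasing_seq s \<and> 0 < liminf (\<lambda>n. ereal (1 / real n * word_entropy M T A s n))"
proof -
  interpret mds M T by fact
  have "eventually (\<lambda>n. ereal (1 / real n * shannon_entropy M
        (common_refinement ((\<lambda>i. pullback_partition M T (s i) {A, space M - A}) ` {..<n})))
      = ereal (1 / real n * word_entropy M T A s n)) sequentially"
    using eventually_gt_at_top[of 0]
    by eventually_elim (simp add: shannon_entropy_eq_word_entropy sets.sets_into_space[OF assms(2)])
  from Liminf_eq[OF this] show ?thesis by (simp add: entropy_generating_def)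
qed

section \<open>Conditional probabilities of a joining\<close>

locale joined_systems = X: invertible_mds M T + Y: mds N S
  for M :: "'a measure" and T and N :: "'b measure" and S +
  fixes \<rho> :: "('a \<times> 'b) measure"
  assumes joining: "joining M T N S \<rho>"
begin

lemma prob_\<rho>: "prob_space \<rho>" and sets_\<rho> [measurable_cong, simp]: "sets \<rho> = sets (M \<Otimes>\<^sub>M N)"
  and invariant_\<rho>: "distr \<rho> (M \<Otimes>\<^sub>M N) (map_prod T S) = \<rho>"
  and fst_\<rho>: "distr \<rho> M fst = M" and snd_\<rho>: "distr \<rho> N snd = N"
  using joining by (auto simp: joining_def)

sublocale R: prob_space \<rho> by (rule prob_\<rho>)

lemma space_\<rho>: "space \<rho> = space M \<times> space N"
  using sets_eq_imp_space_eq[OF sets_\<rho>] by (simp add: space_pair_measure)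

lemma measure_\<rho>_fst: "A \<in> sets M \<Longrightarrow> measure \<rho> (A \<times> space N) = measure M A"
proof -
  assume A: "A \<in> sets M"
  have "fst \<in> \<rho> \<rightarrow>\<^sub>M M" by measurable
  from measure_distr[OF this A] have "measure M A = measure \<rho> (fst -` A \<inter> space \<rho>)"
    by (simp add: fst_\<rho>)
  also have "fst -` A \<inter> space \<rho> = A \<times> space N"
    using sets.sets_into_space[OF A] by (auto simp: space_\<rho>)
  finally show ?thesis by simp
qed

lemma measure_\<rho>_snd: "E \<in> sets N \<Longrightarrow> measure \<rho> (space M \<times> E) = measure N E"
proof -
  assume E: "E \<in> sets N"
  have "snd \<in> \<rho> \<rightarrow>\<^sub>M N" by measurable
  from measure_distr[OF this E] have "measure N E = measure \<rho> (snd -` E \<inter> space \<rho>)"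
    by (simp add: snd_\<rho>)
  also have "snd -` E \<inter> space \<rho> = space M \<times> E"
    using sets.sets_into_space[OF E] by (auto simp: space_\<rho>)
  finally show ?thesis by simp
qed

lemma measure_\<rho>_vimage:
  assumes A: "A \<in> sets M" and E: "E \<in> sets N"
  shows "measure \<rho> ((T -` A \<inter> space M) \<times> (S -` E \<inter> space N)) = measure \<rho> (A \<times> E)"
proof -
  note X.measurable_T[measurable] Y.measurable_T[measurable]
  have "map_prod T S \<in> \<rho> \<rightarrow>\<^sub>M M \<Otimes>\<^sub>M N"
    unfolding map_prod_def by measurable
  moreover have "A \<times> E \<in> sets (M \<Otimes>\<^sub>M N)" using A E by simp
  ultimately have "measure \<rho> (A \<times> E) = measure \<rho> (map_prod T S -` (A \<times> E) \<inter> space \<rho>)"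
    using measure_distr invariant_\<rho> by metis
  also have "map_prod T S -` (A \<times> E) \<inter> space \<rho> = (T -` A \<inter> space M) \<times> (S -` E \<inter> space N)"
    by (auto simp: space_\<rho>)
  finally show ?thesis by simp
qed

text \<open>\<open>f x\<close> is the conditional probability, under the joining, that the second coordinate lies in
  \<open>E\<close> given that the first one is \<open>x\<close>. Being specified on each \<open>E\<close> separately, such functions
  exist on arbitrary probability spaces, where a disintegration of the joining need not exist.\<close>

definition is_fiber_prob :: "'b set \<Rightarrow> ('a \<Rightarrow> real) \<Rightarrow> bool" where
  "is_fiber_prob E f \<longleftrightarrow> integrable M f \<and> (\<forall>A\<in>sets M. (\<integral>x\<in>A. f x \<partial>M) = measure \<rho> (A \<times> E))"

lemma is_fiber_prob_unique:
  assumes "is_fiber_prob E f" "is_fiber_prob E g"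
  shows "AE x in M. f x = g x"
  by (rule density_unique_real) (use assms in \<open>auto simp: is_fiber_prob_def\<close>)

text \<open>Radon--Nikodym for \<open>A \<mapsto> \<rho> (A \<times> E)\<close>, a measure bounded by the marginal
  \<open>M\<close>.\<close>

lemma is_fiber_prob_exists:
  assumes E [measurable]: "E \<in> sets N"
  shows "\<exists>f. is_fiber_prob E f \<and> (\<forall>x. 0 \<le> f x)"
proof -
  define K where "K = distr (density \<rho> (indicator (space M \<times> E))) M fst"
  have K: "emeasure K A = emeasure \<rho> (A \<times> E)" if A: "A \<in> sets M" for A
  proof -
    have [measurable]: "A \<in> sets M" by fact
    have "emeasure K A = emeasure (density \<rho> (indicator (space M \<times> E))) (fst -` A \<inter> space \<rho>)"
      unfolding K_def by (subst emeasure_distr) auto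
    also have "fst -` A \<inter> space \<rho> = A \<times> space N"
      using sets.sets_into_space[OF A] by (auto simp: space_\<rho>)
    also have "emeasure (density \<rho> (indicator (space M \<times> E))) (A \<times> space N) =
        (\<integral>\<^sup>+z. indicator (space M \<times> E) z * indicator (A \<times> space N) z \<partial>\<rho>)"
      by (rule emeasure_density) auto
    also have "\<dots> = (\<integral>\<^sup>+z. indicator (A \<times> E) z \<partial>\<rho>)"
      using sets.sets_into_space[OF A] sets.sets_into_space[OF E]
      by (intro nn_integral_cong) (auto split: split_indicator)
    finally show ?thesis by simp
  qed
  have setsK: "sets K = sets M" by (simp add: K_def)
  have fin: "finite_measure K"
    by (rule finite_measureI) (simp add: sets_eq_imp_space_eq[OF setsK] K)
  have ac: "absolutely_continuous M K"
    unfolding absolutely_continuous_def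
  proof
    fix A assume A: "A \<in> null_sets M"
    then have [measurable]: "A \<in> sets M" by auto
    have "measure \<rho> (A \<times> E) \<le> measure \<rho> (A \<times> space N)"
      using sets.sets_into_space[OF E] by (intro R.finite_measure_mono) auto
    also have "\<dots> = 0"
      using A measure_\<rho>_fst[of A] by (auto simp: measure_def)
    finally have "emeasure K A = 0"
      by (simp add: K R.emeasure_eq_measure measure_le_0_iff)
    then show "A \<in> null_sets K" using setsK by auto
  qed
  obtain D where D [measurable]: "D \<in> borel_measurable M" and RN: "AE x in M. RN_deriv M K x = ennreal (D x)"
    and "AE x in K. 0 < D x" and pos: "\<And>x. 0 \<le> D x"
    by (rule X.real_RN_deriv[OF fin ac setsK], rule that)
  have int: "(\<integral>\<^sup>+x. ennreal (D x * indicator A x) \<partial>M) = ennreal (measure \<rho> (A \<times> E))"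
    if [measurable]: "A \<in> sets M" for A
  proof -
    have "(\<integral>\<^sup>+x. ennreal (D x * indicator A x) \<partial>M) = (\<integral>\<^sup>+x. RN_deriv M K x * indicator A x \<partial>M)"
      by (rule nn_integral_cong_AE) (use RN in eventually_elim, auto split: split_indicator)
    also have "\<dots> = emeasure (density M (RN_deriv M K)) A"
      by (subst emeasure_density) auto
    also have "density M (RN_deriv M K) = K" by (rule X.density_RN_deriv[OF ac setsK])
    finally show ?thesis by (simp add: K R.emeasure_eq_measure)
  qed
  have "integrable M D"
    using int[of "space M"] pos
    by (intro integrableI_nonneg) (auto cong: nn_integral_cong_simp)
  moreover have "(\<integral>x\<in>A. D x \<partial>M) = measure \<rho> (A \<times> E)" if [measurable]: "A \<in> sets M" for A
  proof -
    have "(\<integral>x\<in>A. D x \<partial>M) = enn2real (\<integral>\<^sup>+x. ennreal (D x * indicator A x) \<partial>M)"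
      unfolding set_lebesgue_integral_def
      by (subst integral_eq_nn_integral) (auto simp: pos mult.commute)
    then show ?thesis by (simp add: int)
  qed
  ultimately show ?thesis using pos by (auto simp: is_fiber_prob_def)
qed

definition fiber_prob :: "'b set \<Rightarrow> 'a \<Rightarrow> real" where
  "fiber_prob E = (SOME f. is_fiber_prob E f \<and> (\<forall>x. 0 \<le> f x))"

lemma fiber_prob: 
  assumes "E \<in> sets N"
  shows fiber_prob_is_fiber_prob: "is_fiber_prob E (fiber_prob E)" and fiber_prob_nonneg: "0 \<le> fiber_prob E x"
  using someI_ex[OF is_fiber_prob_exists[OF assms]] by (auto simp: fiber_prob_def)

lemma fiber_prob_integrable: "E \<in> sets N \<Longrightarrow> integrable M (fiber_prob E)"
  and fiber_prob_set_integral: "E \<in> sets N \<Longrightarrow> A \<in> sets M \<Longrightarrow> (\<integral>x\<in>A. fiber_prob E x \<partial>M) = measure \<rho> (A \<times> E)"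
  using fiber_prob_is_fiber_prob by (auto simp: is_fiber_prob_def)

lemma fiber_prob_integral:
  assumes "E \<in> sets N"
  shows "(\<integral>x. fiber_prob E x \<partial>M) = measure N E"
proof -
  have "(\<integral>x. fiber_prob E x \<partial>M) = (\<integral>x\<in>space M. fiber_prob E x \<partial>M)"
    by (rule set_integral_space[symmetric]) (rule fiber_prob_integrable[OF assms])
  then show ?thesis
    using fiber_prob_set_integral[OF assms] measure_\<rho>_snd[OF assms] by simp
qed

lemma AE_fiber_prob_eq:
  assumes "E \<in> sets N" "is_fiber_prob E f"
  shows "AE x in M. fiber_prob E x = f x"
  using is_fiber_prob_unique[OF fiber_prob_is_fiber_prob[OF assms(1)] assms(2)] .

lemma AE_fiber_prob_null:
  assumes E: "E \<in> sets N" and 0: "measure N E = 0"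
  shows "AE x in M. fiber_prob E x = 0"
proof -
  have "(\<integral>x. fiber_prob E x \<partial>M) = 0" using fiber_prob_integral[OF E] 0 by simp
  then show ?thesis
    using integral_nonneg_eq_0_iff_AE[OF fiber_prob_integrable[OF E]] fiber_prob_nonneg[OF E] by simp
qed

lemma AE_fiber_prob_const:
  assumes E: "E \<in> sets N" and "\<And>A. A \<in> sets M \<Longrightarrow> measure \<rho> (A \<times> E) = measure M A * c"
  shows "AE x in M. fiber_prob E x = c"
  by (rule AE_fiber_prob_eq[OF E]) (use assms in \<open>auto simp: is_fiber_prob_def set_lebesgue_integral_def\<close>)

lemma AE_fiber_prob_space: "AE x in M. fiber_prob (space N) x = 1"
  by (rule AE_fiber_prob_const) (auto simp: measure_\<rho>_fst)

lemma AE_fiber_prob_UN: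
  assumes W: "finite W" and E: "\<And>w. w \<in> W \<Longrightarrow> E w \<in> sets N" and disj: "disjoint_family_on E W"
  shows "AE x in M. fiber_prob (\<Union>w\<in>W. E w) x = (\<Sum>w\<in>W. fiber_prob (E w) x)"
proof (rule AE_fiber_prob_eq)
  show "(\<Union>w\<in>W. E w) \<in> sets N" using W E by auto
  show "is_fiber_prob (\<Union>w\<in>W. E w) (\<lambda>x. \<Sum>w\<in>W. fiber_prob (E w) x)"
    unfolding is_fiber_prob_def
  proof (intro conjI ballI)
    show "integrable M (\<lambda>x. \<Sum>w\<in>W. fiber_prob (E w) x)"
      by (intro Bochner_Integration.integrable_sum fiber_prob_integrable E)
    fix A assume A: "A \<in> sets M"
    have "(\<integral>x\<in>A. (\<Sum>w\<in>W. fiber_prob (E w) x) \<partial>M) = (\<Sum>w\<in>W. \<integral>x\<in>A. fiber_prob (E w) x \<partial>M)"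
      unfolding set_lebesgue_integral_def scaleR_sum_right
      by (rule Bochner_Integration.integral_sum)
        (intro integrable_mult_indicator A fiber_prob_integrable E)
    also have "\<dots> = (\<Sum>w\<in>W. measure \<rho> (A \<times> E w))"
      by (rule sum.cong[OF refl]) (rule fiber_prob_set_integral[OF E A])
    also have "\<dots> = measure \<rho> (\<Union>w\<in>W. A \<times> E w)"
      by (rule R.finite_measure_finite_Union[symmetric])
        (use W A E disj in \<open>auto simp: disjoint_family_on_def\<close>)
    also have "(\<Union>w\<in>W. A \<times> E w) = A \<times> (\<Union>w\<in>W. E w)" by auto
    finally show "(\<integral>x\<in>A. (\<Sum>w\<in>W. fiber_prob (E w) x) \<partial>M) = measure \<rho> (A \<times> (\<Union>w\<in>W. E w))" .
  qed
qed

text \<open>Here invertibility of \<open>T\<close> enters: every measurable \<open>A\<close> is the preimage of a measurable \<open>A'\<close>,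
  so that invariance on the rectangle \<open>A' \<times> E\<close> determines the conditional probability
  of the preimage of \<open>E\<close> over \<open>A\<close>. Without it only the projection to the preimage algebra
  would be known.\<close>

lemma AE_fiber_prob_vimage:
  assumes E: "E \<in> sets N"
  shows "AE x in M. fiber_prob (S -` E \<inter> space N) x = fiber_prob E (T x)"
proof (rule AE_fiber_prob_eq)
  show SE: "S -` E \<inter> space N \<in> sets N" using Y.measurable_T E by (rule measurable_sets)
  show "is_fiber_prob (S -` E \<inter> space N) (\<lambda>x. fiber_prob E (T x))"
    unfolding is_fiber_prob_def
  proof (intro conjI ballI)
    show int: "integrable M (\<lambda>x. fiber_prob E (T x))"
      using integrable_distr[OF X.measurable_T, of "fiber_prob E"] fiber_prob_integrable[OF E]
      by (simp add: X.preserves_T)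
    fix A assume A: "A \<in> sets M"
    define A' where "A' = the_inv_into (space M) T -` A \<inter> space M"
    have A': "A' \<in> sets M"
      unfolding A'_def using X.measurable_inv_T A by (rule measurable_sets)
    have inj: "inj_on T (space M)" using X.bij_T by (rule bij_betw_imp_inj_on)
    have TA': "T x \<in> A' \<longleftrightarrow> x \<in> A" if "x \<in> space M" for x
      using that measurable_space[OF X.measurable_T that] the_inv_into_f_f[OF inj that]
      by (simp add: A'_def)
    then have eq: "T -` A' \<inter> space M = A"
      using sets.sets_into_space[OF A] by auto
    have [measurable]: "fiber_prob E \<in> borel_measurable M" using fiber_prob_integrable[OF E] by simp
    note X.measurable_T[measurable]
    have "(\<integral>x\<in>A. fiber_prob E (T x) \<partial>M) = (\<integral>x. indicator A' (T x) *\<^sub>R fiber_prob E (T x) \<partial>M)"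
      unfolding set_lebesgue_integral_def
      by (rule Bochner_Integration.integral_cong) (auto simp: TA' split: split_indicator)
    also have "\<dots> = (\<integral>x. indicator A' x *\<^sub>R fiber_prob E x \<partial>distr M M T)"
      by (rule integral_distr[symmetric]) (use A' in auto)
    also have "\<dots> = measure \<rho> (A' \<times> E)"
      using fiber_prob_set_integral[OF E A'] by (simp add: X.preserves_T set_lebesgue_integral_def)
    also have "\<dots> = measure \<rho> (A \<times> (S -` E \<inter> space N))"
      using measure_\<rho>_vimage[OF A' E] by (simp add: eq)
    finally show "(\<integral>x\<in>A. fiber_prob E (T x) \<partial>M) = measure \<rho> (A \<times> (S -` E \<inter> space N))" .
  qed
qed

lemma AE_fiber_prob_vimage_pow:
  assumes E: "E \<in> sets N"
  shows "AE x in M. fiber_prob ((S ^^ m) -` E \<inter> space N) x = fiber_prob E ((T ^^ m) x)"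
proof (induction m)
  case 0
  have "(S ^^ 0) -` E \<inter> space N = E" using sets.sets_into_space[OF E] by auto
  then show ?case by simp
next
  case (Suc m)
  let ?F = "(S ^^ m) -` E \<inter> space N"
  have F: "?F \<in> sets N" using Y.measurable_pow E by (rule measurable_sets)
  have eq: "(S ^^ Suc m) -` E \<inter> space N = S -` ?F \<inter> space N"
    using measurable_space[OF Y.measurable_T] by (auto simp: funpow_swap1)
  have "AE x in distr M M T. fiber_prob ?F x = fiber_prob E ((T ^^ m) x)"
    unfolding X.preserves_T by (rule Suc)
  then have "AE x in M. fiber_prob ?F (T x) = fiber_prob E ((T ^^ m) (T x))"
    using AE_distrD[OF X.measurable_T] by fastforce
  then show ?case
    using AE_fiber_prob_vimage[OF F] unfolding eq by eventually_elim (simp add: funpow_swap1)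
qed

section \<open>Transfer of entropy through a joining\<close>

text \<open>Given \<open>x\<close>, sample \<open>k\<close> conditionally independent \<open>Y\<close>-words. Equivariance of \<open>fiber_prob\<close> says
  that letter \<open>i\<close> of such a word is one with probability \<open>fiber_prob B ((T ^^ s i) x)\<close>, and
  letter \<open>i\<close> of the \<open>X\<close>-word records whether this number exceeds \<open>t\<close>; so the vote recovers the
  \<open>X\<close>-word up to few errors. By the Gibbs inequality the entropy of the \<open>X\<close>-word is at most
  its mean cost under \<open>guess\<close>. The cost is bounded pointwise, and the bound is integrated: the
  conditional word probabilities integrate to the word probabilities of \<open>Y\<close>, and stationarity
  makes the expected number of near-threshold positions \<open>n\<close> times a measure. The point is that
  \<open>k\<close> and the error rate are independent of \<open>n\<close>.\<close>

lemma word_entropy_le: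
  fixes t :: real
  assumes B: "B \<in> sets N" and \<delta>: "0 < \<delta>" "\<delta> < 1" and k: "0 < k" and \<epsilon>: "0 \<le> \<epsilon>"
  defines "A \<equiv> {x \<in> space M. t < fiber_prob B x}"
  shows "word_entropy M T A s n \<le> real k * word_entropy N S B s n
     + real n * (- ln (1 - \<delta>) + - ln \<delta> * (2 * exp (- 2 * real k * \<epsilon>\<^sup>2)
         + measure M {x \<in> space M. \<bar>fiber_prob B x - t\<bar> \<le> \<epsilon>}))"
proof -
  let ?W = "Pow {..<n} :: nat set set" and ?C = "cell N S B s n" and ?D = "cell M T A s n"
  let ?Z = "{x \<in> space M. \<bar>fiber_prob B x - t\<bar> \<le> \<epsilon>}"
  have [measurable]: "fiber_prob B \<in> borel_measurable M" using fiber_prob_integrable[OF B] by simp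
  have A [measurable]: "A \<in> sets M" unfolding A_def by measurable
  have Z [measurable]: "?Z \<in> sets M" by measurable
  note X.measurable_pow[measurable]
  have C: "?C v \<in> sets N" for v by (rule Y.cell_sets[OF B])
  have D [measurable]: "?D u \<in> sets M" for u by (rule X.cell_sets[OF A])
  obtain \<nu> where \<nu>: "\<And>v. v \<in> ?W \<Longrightarrow> pmf \<nu> v = measure N (?C v)" and \<nu>W: "set_pmf \<nu> \<subseteq> ?W"
    using pmf_of_weights[of ?W "\<lambda>v. measure N (?C v)"] Y.sum_measure_cells[OF B] by auto
  \<comment> \<open>\<open>f x\<close> is the cost of the word of \<open>x\<close>, written as a finite sum over cells to be integrable;
    \<open>b x\<close> is its bound.\<close>
  define c where "c u = - ln (guess \<nu> \<delta> k t n u)" for u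
  define f where "f x = (\<Sum>u\<in>?W. indicator (?D u) x * c u)" for x
  define h where "h v = - ln (measure N (?C v))" for v
  let ?e = "\<lambda>i x. 2 * exp (- 2 * real k * \<epsilon>\<^sup>2) + indicator ?Z ((T ^^ s i) x) :: real"
  define b where "b x = real k * (\<Sum>v\<in>?W. fiber_prob (?C v) x * h v)
      + real n * - ln (1 - \<delta>) + - ln \<delta> * (\<Sum>i<n. ?e i x)" for x
  have UN: "(\<Union>v\<in>{v\<in>?W. i \<in> v}. ?C v) = (S ^^ s i) -` B \<inter> space N" if "i < n" for i
    using that word_subset[of S B s n] by (fastforce simp: cell_def word_def)
  have UN_all: "(\<Union>v\<in>?W. ?C v) = space N"
    using word_subset[of S B s n] by (fastforce simp: cell_def)
  have disj: "disjoint_family_on ?C V" for V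
    by (auto simp: disjoint_family_on_def cell_def)
  have finW: "finite ?W" and finW': "finite {v\<in>?W. i \<in> v}" for i by simp_all
  \<comment> \<open>Outside a null set the conditional probabilities of the finitely many words form a
    probability vector with the right one-letter marginals, supported where the weights of \<open>\<nu>\<close> are positive.\<close>
  have ae_one: "AE x in M. (\<Sum>v\<in>?W. fiber_prob (?C v) x) = 1"
    using AE_fiber_prob_UN[of ?W ?C, OF finW C disj] AE_fiber_prob_space unfolding UN_all
    by eventually_elim simp
  have ae_coord: "AE x in M. \<forall>i\<in>{..<n}. (\<Sum>v\<in>{v\<in>?W. i \<in> v}. fiber_prob (?C v) x) = fiber_prob B ((T ^^ s i) x)"
  proof (rule AE_finite_allI)
    fix i assume "i \<in> {..<n}"
    then have i: "i < n" by simp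
    show "AE x in M. (\<Sum>v\<in>{v\<in>?W. i \<in> v}. fiber_prob (?C v) x) = fiber_prob B ((T ^^ s i) x)"
      using AE_fiber_prob_UN[of "{v\<in>?W. i \<in> v}" ?C, OF finW' C disj] AE_fiber_prob_vimage_pow[OF B, of "s i"]
      unfolding UN[OF i] by eventually_elim simp
  qed simp
  have ae_null: "AE x in M. \<forall>v\<in>?W. measure N (?C v) = 0 \<longrightarrow> fiber_prob (?C v) x = 0"
    by (rule AE_finite_allI) (use AE_fiber_prob_null[OF C] in auto)
  have f_le_b: "AE x in M. f x \<le> b x"
    using ae_one ae_coord ae_null AE_space
  proof eventually_elim
    fix x assume one: "(\<Sum>v\<in>?W. fiber_prob (?C v) x) = 1"
      and coord: "\<forall>i\<in>{..<n}. (\<Sum>v\<in>{v\<in>?W. i \<in> v}. fiber_prob (?C v) x) = fiber_prob B ((T ^^ s i) x)"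
      and null: "\<forall>v\<in>?W. measure N (?C v) = 0 \<longrightarrow> fiber_prob (?C v) x = 0"
      and x: "x \<in> space M"
    obtain \<rho>x where \<rho>x: "\<And>v. v \<in> ?W \<Longrightarrow> pmf \<rho>x v = fiber_prob (?C v) x" and \<rho>W: "set_pmf \<rho>x \<subseteq> ?W"
      using pmf_of_weights[of ?W "\<lambda>v. fiber_prob (?C v) x"] one fiber_prob_nonneg[OF C] by auto
    have q: "measure_pmf.prob \<rho>x {v. i \<in> v} = fiber_prob B ((T ^^ s i) x)" if "i < n" for i
    proof -
      have "measure_pmf.prob \<rho>x {v. i \<in> v} = measure_pmf.prob \<rho>x {v\<in>?W. i \<in> v}"
        by (rule measure_pmf.finite_measure_eq_AE) (use \<rho>W in \<open>auto simp: AE_measure_pmf_iff\<close>)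
      also have "\<dots> = (\<Sum>v\<in>{v\<in>?W. i \<in> v}. pmf \<rho>x v)"
        by (rule measure_measure_pmf_finite) simp
      also have "\<dots> = (\<Sum>v\<in>{v\<in>?W. i \<in> v}. fiber_prob (?C v) x)"
        by (rule sum.cong[OF refl]) (simp add: \<rho>x)
      finally show ?thesis using coord that by simp
    qed
    have "set_pmf \<rho>x \<subseteq> set_pmf \<nu>"
    proof
      fix v assume v: "v \<in> set_pmf \<rho>x"
      then have W: "v \<in> ?W" using \<rho>W by blast
      then have "measure N (?C v) \<noteq> 0" using v null \<rho>x[OF W] by (auto simp: set_pmf_iff)
      then show "v \<in> set_pmf \<nu>" using \<nu>[OF W] by (simp add: set_pmf_iff)
    qed
    moreover have "finite (set_pmf \<rho>x)" by (rule finite_subset[OF \<rho>W]) simp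
    moreover have "i \<in> word T A s n x \<longleftrightarrow> t < measure_pmf.prob \<rho>x {v. i \<in> v}" if "i < n" for i
      using that X.pow_in_space[OF x] by (simp add: q word_def A_def)
    ultimately have "c (word T A s n x) \<le>
       real k * measure_pmf.expectation \<rho>x (\<lambda>v. - ln (pmf \<nu> v)) + real n * - ln (1 - \<delta>)
       + - ln \<delta> * (\<Sum>i<n. 2 * exp (- 2 * real k * \<epsilon>\<^sup>2)
           + (if \<bar>measure_pmf.prob \<rho>x {v. i \<in> v} - t\<bar> \<le> \<epsilon> then 1 else 0))"
      unfolding c_def by (intro guess_cost \<delta> k \<epsilon>)
    also have "measure_pmf.expectation \<rho>x (\<lambda>v. - ln (pmf \<nu> v)) = (\<Sum>v\<in>?W. fiber_prob (?C v) x * h v)"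
      by (subst integral_measure_pmf_real[of ?W]) (use \<rho>W in \<open>auto simp: \<rho>x \<nu> h_def mult.commute intro!: sum.cong\<close>)
    also have "(\<Sum>i<n. 2 * exp (- 2 * real k * \<epsilon>\<^sup>2)
           + (if \<bar>measure_pmf.prob \<rho>x {v. i \<in> v} - t\<bar> \<le> \<epsilon> then 1 else 0)) = (\<Sum>i<n. ?e i x)"
      by (rule sum.cong[OF refl]) (simp add: q X.pow_in_space[OF x] indicator_def)
    finally have "c (word T A s n x) \<le> b x" by (simp add: b_def)
    moreover have "f x = c (word T A s n x)"
    proof -
      have "f x = (\<Sum>u\<in>?W. if u = word T A s n x then c u else 0)"
        unfolding f_def by (rule sum.cong[OF refl]) (use x in \<open>auto simp: cell_def split: split_indicator\<close>)
      also have "\<dots> = c (word T A s n x)"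
        using word_subset[of T A s n x] by (simp add: sum.delta)
      finally show ?thesis .
    qed
    ultimately show "f x \<le> b x" by simp
  qed
  have D_int: "integrable M (\<lambda>x. indicator (?D u) x * c u)" for u
    by (intro integrable_mult_left integrable_real_indicator D) (simp add: X.emeasure_eq_measure)
  have f_int: "integrable M f"
    unfolding f_def by (intro Bochner_Integration.integrable_sum D_int)
  have e_int: "integrable M (?e i)" for i
    by (rule X.integrable_const_bound[where B = "2 * exp (- 2 * real k * \<epsilon>\<^sup>2) + 1"])
      (auto split: split_indicator)
  have g_int: "integrable M (\<lambda>x. fiber_prob (?C v) x * h v)" for v
    by (intro integrable_mult_left fiber_prob_integrable C)
  have b_int: "integrable M b"
    unfolding b_def by (intro Bochner_Integration.integrable_add integrable_mult_right Bochner_Integration.integrable_sum g_int e_int X.integrable_const)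
  have "(\<integral>x. f x \<partial>M) \<le> (\<integral>x. b x \<partial>M)"
    by (rule integral_mono_AE[OF f_int b_int f_le_b])
  also have "(\<integral>x. b x \<partial>M) = real k * (\<Sum>v\<in>?W. measure N (?C v) * h v)
      + real n * - ln (1 - \<delta>) + - ln \<delta> * (\<Sum>i<n. \<integral>x. ?e i x \<partial>M)"
  proof -
    have G: "(\<integral>x. (\<Sum>v\<in>?W. fiber_prob (?C v) x * h v) \<partial>M) = (\<Sum>v\<in>?W. measure N (?C v) * h v)"
      by (subst Bochner_Integration.integral_sum[OF g_int]) (simp add: fiber_prob_integral[OF C])
    have F: "(\<integral>x. (\<Sum>i<n. ?e i x) \<partial>M) = (\<Sum>i<n. \<integral>x. ?e i x \<partial>M)"
      by (rule Bochner_Integration.integral_sum[OF e_int])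
    have 1: "integrable M (\<lambda>x. real k * (\<Sum>v\<in>?W. fiber_prob (?C v) x * h v))"
      by (intro integrable_mult_right Bochner_Integration.integrable_sum g_int)
    have 2: "integrable M (\<lambda>x. - ln \<delta> * (\<Sum>i<n. ?e i x))"
      by (intro integrable_mult_right Bochner_Integration.integrable_sum e_int)
    have 3: "integrable M (\<lambda>x. real n * - ln (1 - \<delta>))" by simp
    show ?thesis
      unfolding b_def Bochner_Integration.integral_add[OF Bochner_Integration.integrable_add[OF 1 3] 2]
        Bochner_Integration.integral_add[OF 1 3] integral_mult_right_zero G F
      by (simp add: X.prob_space)
  qed
  also have "(\<Sum>v\<in>?W. measure N (?C v) * h v) = word_entropy N S B s n"
    by (simp add: h_def word_entropy_def sum_negf)
  also have "(\<Sum>i<n. \<integral>x. ?e i x \<partial>M) = real n * (2 * exp (- 2 * real k * \<epsilon>\<^sup>2) + measure M ?Z)"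
  proof -
    have "(\<integral>x. ?e i x \<partial>M) = 2 * exp (- 2 * real k * \<epsilon>\<^sup>2) + measure M ?Z" for i
    proof -
      have ind: "(\<integral>x. indicator ?Z ((T ^^ s i) x) \<partial>M) = measure M ?Z"
      proof -
        have "(\<integral>x. (indicator ?Z ((T ^^ s i) x) :: real) \<partial>M) = (\<integral>x. indicator ?Z x \<partial>distr M M (T ^^ s i))"
          by (rule integral_distr[symmetric]) auto
        then show ?thesis by (simp add: X.preserves_pow)
      qed
      have "integrable M (\<lambda>x. indicator ?Z ((T ^^ s i) x) :: real)"
        by (rule X.integrable_const_bound[where B = 1]) auto
      then show ?thesis using ind by (subst Bochner_Integration.integral_add) (auto simp: X.prob_space)
    qed
    then show ?thesis by simp
  qed
  finally have upper: "(\<integral>x. f x \<partial>M) \<le> real k * word_entropy N S B s n + real n * - ln (1 - \<delta>)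
      + - ln \<delta> * (real n * (2 * exp (- 2 * real k * \<epsilon>\<^sup>2) + measure M ?Z))" .
  have "word_entropy M T A s n \<le> (\<Sum>u\<in>?W. measure M (?D u) * - ln (guess \<nu> \<delta> k t n u))"
    unfolding word_entropy_def
    by (rule gibbs_inequality) (simp_all add: guess_pos \<delta> sum_guess X.sum_measure_cells[OF A])
  also have "\<dots> = (\<integral>x. f x \<partial>M)"
    unfolding f_def Bochner_Integration.integral_sum[OF D_int] by (simp add: c_def)
  finally show ?thesis using upper by (simp add: algebra_simps)
qed

text \<open>If each \<open>fiber_prob B\<close> were almost surely constant, \<open>\<rho>\<close> would factor on rectangles. So
  some \<open>fiber_prob B\<close> takes values on both sides of its mean with positive probability. A
  threshold slightly below the mean then cuts \<open>X\<close> into two sets of positive measure, and only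
  countably many thresholds are atoms of the distribution of \<open>fiber_prob B\<close>.\<close>

lemma dependent_threshold:
  assumes "\<rho> \<noteq> M \<Otimes>\<^sub>M N"
  obtains B t where "B \<in> sets N" "0 < measure N B" "measure N B < 1"
    "0 < measure M {x \<in> space M. t < fiber_prob B x}" "measure M {x \<in> space M. t < fiber_prob B x} < 1"
    "measure M {x \<in> space M. fiber_prob B x = t} = 0"
proof -
  have "\<exists>B\<in>sets N. \<exists>A\<in>sets M. measure \<rho> (A \<times> B) \<noteq> measure M A * measure N B"
  proof (rule ccontr)
    assume *: "\<not> ?thesis"
    have "M \<Otimes>\<^sub>M N = \<rho>"
    proof (rule pair_measure_eqI)
      fix A B assume "A \<in> sets M" "B \<in> sets N"
      then show "emeasure M A * emeasure N B = emeasure \<rho> (A \<times> B)"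
        using * by (simp add: X.emeasure_eq_measure Y.emeasure_eq_measure R.emeasure_eq_measure ennreal_mult)
    qed (auto intro: X.sigma_finite_measure_axioms Y.sigma_finite_measure_axioms)
    with assms show False by simp
  qed
  then obtain A B where A: "A \<in> sets M" and B: "B \<in> sets N"
    and dep: "measure \<rho> (A \<times> B) \<noteq> measure M A * measure N B" by blast
  define m where "m = measure N B"
  let ?f = "fiber_prob B"
  have f_int: "integrable M ?f" by (rule fiber_prob_integrable[OF B])
  then have [measurable]: "?f \<in> borel_measurable M" by simp
  have not_const: "\<not> (AE x in M. ?f x = m)"
  proof
    assume ae: "AE x in M. ?f x = m"
    have "(\<integral>x\<in>A. ?f x \<partial>M) = (\<integral>x\<in>A. m \<partial>M)"
      by (rule set_lebesgue_integral_cong_AE) (use A ae in auto)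
    then show False
      using dep A fiber_prob_set_integral[OF B A] by (simp add: m_def set_lebesgue_integral_def)
  qed
  have mean: "(\<integral>x. ?f x \<partial>M) = m" unfolding m_def by (rule fiber_prob_integral[OF B])
  have not_le: "\<not> (AE x in M. ?f x \<le> m)"
  proof
    assume "AE x in M. ?f x \<le> m"
    then have "AE x in M. m - ?f x = 0"
      using mean by (subst integral_nonneg_eq_0_iff_AE[symmetric]) (auto simp: f_int X.prob_space)
    then have "AE x in M. ?f x = m" by eventually_elim simp
    with not_const show False ..
  qed
  have not_ge: "\<not> (AE x in M. m \<le> ?f x)"
  proof
    assume "AE x in M. m \<le> ?f x"
    then have "AE x in M. ?f x - m = 0"
      using mean by (subst integral_nonneg_eq_0_iff_AE[symmetric]) (auto simp: f_int X.prob_space)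
    then have "AE x in M. ?f x = m" by eventually_elim simp
    with not_const show False ..
  qed
  \<comment> \<open>All thresholds in \<open>{l<..<m}\<close> split the space nontrivially.\<close>
  obtain l where l: "l < m" "\<not> (AE x in M. l < ?f x)"
  proof (rule ccontr)
    assume "\<not> thesis"
    with that have "AE x in M. m - 1 / real (Suc j) < ?f x" for j by force
    then have "AE x in M. \<forall>j. m - 1 / real (Suc j) < ?f x" by (simp add: AE_all_countable)
    then have "AE x in M. m \<le> ?f x"
    proof eventually_elim
      fix x assume *: "\<forall>j. m - 1 / real (Suc j) < ?f x"
      show "m \<le> ?f x"
      proof (rule ccontr)
        assume "\<not> m \<le> ?f x"
        then obtain j where "1 / real (Suc j) < m - ?f x"
          using nat_approx_posE[of "m - ?f x"] by auto
        with * show False by (smt (verit))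
      qed
    qed
    with not_ge show False by blast
  qed
  interpret D: prob_space "distr M borel ?f" by (rule X.prob_space_distr) simp
  have "uncountable ({l<..<m} - {r. measure (distr M borel ?f) {r} \<noteq> 0})"
    using l(1) by (intro uncountable_minus_countable D.countable_support) (simp add: uncountable_open_interval)
  then have "{l<..<m} - {r. measure (distr M borel ?f) {r} \<noteq> 0} \<noteq> {}"
    by (rule contrapos_nn) (simp only: countable_empty)
  then obtain t where t: "l < t" "t < m" and atom: "measure (distr M borel ?f) {t} = 0"
    by auto
  have null: "measure M {x \<in> space M. ?f x = t} = 0"
    using atom by (subst (asm) measure_distr) (auto simp: vimage_def Int_def conj_commute)
  have pos: "0 < measure M {x \<in> space M. t < ?f x}"
  proof (rule ccontr)
    assume "\<not> ?thesis"
    then have "measure M {x \<in> space M. t < ?f x} = 0" using measure_nonneg[of M] by (smt (verit))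
    then have "AE x in M. \<not> t < ?f x"
      by (subst (asm) X.prob_eq_0) auto
    then have "AE x in M. ?f x \<le> m" by eventually_elim (use t in linarith)
    with not_le show False ..
  qed
  have less: "measure M {x \<in> space M. t < ?f x} < 1"
  proof (rule ccontr)
    assume "\<not> ?thesis"
    then have "measure M {x \<in> space M. t < ?f x} = 1" using X.prob_le_1 by (smt (verit))
    then have "AE x in M. t < ?f x" by (subst (asm) X.prob_Collect_eq_1) auto
    then have "AE x in M. l < ?f x" by eventually_elim (use t in linarith)
    with l show False by blast
  qed
  have "measure N B \<noteq> 0"
    using AE_fiber_prob_null[OF B] not_const by (auto simp: m_def)
  moreover have "measure N B \<noteq> 1"
  proof
    assume 1: "measure N B = 1"
    then have compl: "measure N (space N - B) = 0" by (simp add: Y.prob_compl[OF B])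
    have "measure \<rho> (A \<times> B) = measure \<rho> (A \<times> space N) - measure \<rho> (A \<times> (space N - B))"
    proof -
      have "measure \<rho> (A \<times> space N) = measure \<rho> (A \<times> B \<union> A \<times> (space N - B))"
        using sets.sets_into_space[OF B] by (intro arg_cong[where f = "measure \<rho>"]) auto
      also have "\<dots> = measure \<rho> (A \<times> B) + measure \<rho> (A \<times> (space N - B))"
        by (rule R.finite_measure_Union) (use A B in auto)
      finally show ?thesis by simp
    qed
    moreover have "measure \<rho> (A \<times> (space N - B)) \<le> measure \<rho> (space M \<times> (space N - B))"
      using A B sets.sets_into_space[OF A] by (intro R.finite_measure_mono) auto
    moreover have "measure \<rho> (space M \<times> (space N - B)) = 0"
      using compl B by (subst measure_\<rho>_snd) auto
    ultimately show False
      using dep 1 measure_\<rho>_fst[OF A] measure_nonneg[of \<rho> "A \<times> (space N - B)"] by simp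
  qed
  ultimately show thesis
    using that[OF B _ _ pos less null] Y.prob_le_1[of B] measure_nonneg[of N B] by (smt (verit))
qed

text \<open>With errors costing less than half of the entropy rate \<open>c\<close> of the \<open>X\<close>-partition, the \<open>k\<close>
  copies of the \<open>Y\<close>-partition must carry the other half, so one copy has entropy rate at least
  \<open>c / (2 * k)\<close> along the same sequence.\<close>

lemma generating_transfer:
  assumes B: "B \<in> sets N" and atom: "measure M {x \<in> space M. fiber_prob B x = t} = 0"
  defines "A \<equiv> {x \<in> space M. t < fiber_prob B x}"
  assumes gen: "entropy_generating M T {A, space M - A} s"
  shows "entropy_generating N S {B, space N - B} s"
proof -
  have f_meas [measurable]: "fiber_prob B \<in> borel_measurable M" using fiber_prob_integrable[OF B] by simp
  have A: "A \<in> sets M" unfolding A_def by measurable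
  let ?a = "\<lambda>n. 1 / real n * word_entropy M T A s n" and ?b = "\<lambda>n. 1 / real n * word_entropy N S B s n"
  have s: "increasing_seq s" and "0 < liminf (\<lambda>n. ereal (?a n))"
    using gen entropy_generating_iff_word_entropy[OF X.mds_axioms A] by auto
  then obtain c where c: "0 < ereal c" "ereal c < liminf (\<lambda>n. ereal (?a n))"
    using ereal_dense2 by blast
  then have ev: "eventually (\<lambda>n. c < ?a n) sequentially"
    using less_LiminfD[OF c(2)] by simp
  have "0 < c / 2" using c by simp
  obtain \<delta> \<epsilon> k where par: "0 < \<delta>" "\<delta> < 1" "0 < k" "0 \<le> \<epsilon>"
    and small: "- ln (1 - \<delta>) + - ln \<delta> * (2 * exp (- 2 * real k * \<epsilon>\<^sup>2)
       + measure M {x \<in> space M. \<bar>fiber_prob B x - t\<bar> \<le> \<epsilon>}) < c / 2" (is "?r < _")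
    by (rule exists_accuracy[OF X.finite_measure_axioms f_meas atom \<open>0 < c / 2\<close>])
  have "eventually (\<lambda>n. ereal (c / (2 * real k)) \<le> ereal (?b n)) sequentially"
    using ev eventually_gt_at_top[of 0]
  proof eventually_elim
    fix n assume n: "c < ?a n" "0 < n"
    have "real n * c \<le> word_entropy M T A s n" using n by (simp add: field_simps)
    also have "\<dots> \<le> real k * word_entropy N S B s n + real n * ?r"
      unfolding A_def by (rule word_entropy_le[OF B par])
    also have "\<dots> \<le> real k * word_entropy N S B s n + real n * (c / 2)"
      using small by (intro add_left_mono mult_left_mono) auto
    finally show "ereal (c / (2 * real k)) \<le> ereal (?b n)"
      using n(2) par(3) by (simp add: field_simps)
  qed
  then have "ereal (c / (2 * real k)) \<le> liminf (\<lambda>n. ereal (?b n))" by (rule Liminf_bounded)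
  moreover have "0 < ereal (c / (2 * real k))" using c par by simp
  ultimately have "0 < liminf (\<lambda>n. ereal (?b n))" by (rule less_le_trans[rotated])
  with s show ?thesis unfolding entropy_generating_iff_word_entropy[OF Y.mds_axioms B] ..
qed

end

section \<open>Entropy dimensions and disjointness\<close>

lemma partition_in_finite_partitions:
  assumes "prob_space N" "B \<in> sets N" "0 < measure N B" "measure N B < 1"
  shows "{B, space N - B} \<in> finite_partitions N"
proof -
  interpret prob_space N by fact
  have "B \<noteq> {}" "B \<noteq> space N" "B \<subseteq> space N"
    using assms sets.sets_into_space[OF assms(2)] by (auto simp: prob_space)
  then have "partition_on (space N) {B, space N - B}"
    by (intro partition_onI) (auto simp: disjnt_def)
  then show ?thesis
    using assms(2) by (simp add: finite_partitions_def)
qed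

lemma upper_entropy_dim_partition_bounds:
  shows "0 \<le> upper_entropy_dim_partition M T \<alpha>" "upper_entropy_dim_partition M T \<alpha> \<le> 1"
proof -
  define D where "D = {upper_dimension s | s. entropy_generating M T \<alpha> s}"
  have D: "0 \<le> d" "d \<le> 1" if "d \<in> D" for d
    using that upper_dimension_bounds unfolding D_def entropy_generating_def by blast+
  have bdd: "bdd_above D" by (rule bdd_aboveI[OF D(2)])
  have "0 \<le> Sup D \<and> Sup D \<le> 1" if ne: "D \<noteq> {}"
  proof
    obtain d where d: "d \<in> D" using ne by blast
    show "0 \<le> Sup D" by (rule cSup_upper2[OF d D(1)[OF d] bdd])
    show "Sup D \<le> 1" by (rule cSup_least[OF ne D(2)])
  qed
  moreover have "D \<noteq> {}" if "\<exists>s. entropy_generating M T \<alpha> s" using that by (simp add: D_def)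
  ultimately show "0 \<le> upper_entropy_dim_partition M T \<alpha>" "upper_entropy_dim_partition M T \<alpha> \<le> 1"
    unfolding upper_entropy_dim_partition_def D_def[symmetric] by simp_all
qed

lemma upper_entropy_dim_partition_le:
  assumes "\<alpha> \<in> finite_partitions M"
  shows "upper_entropy_dim_partition M T \<alpha> \<le> upper_entropy_dim M T"
  unfolding upper_entropy_dim_def
  by (rule cSUP_upper[OF assms]) (rule bdd_aboveI2[OF upper_entropy_dim_partition_bounds(2)])

lemma upper_entropy_dim_partition_mono:
  assumes "\<And>s. entropy_generating M T \<alpha> s \<Longrightarrow> entropy_generating N S \<beta> s"
  shows "upper_entropy_dim_partition M T \<alpha> \<le> upper_entropy_dim_partition N S \<beta>"
proof (cases "\<exists>s. entropy_generating M T \<alpha> s")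
  case True
  let ?D = "{upper_dimension s | s. entropy_generating M T \<alpha> s}"
    and ?E = "{upper_dimension s | s. entropy_generating N S \<beta> s}"
  have "bdd_above ?E"
    using upper_dimension_bounds(2) unfolding entropy_generating_def
    by (intro bdd_aboveI[of _ 1]) blast
  moreover have "?D \<subseteq> ?E" using assms by blast
  moreover have "?D \<noteq> {}" using True by simp
  ultimately have "Sup ?D \<le> Sup ?E" by (intro cSup_subset_mono)
  moreover have "\<exists>s. entropy_generating N S \<beta> s" using True assms by blast
  ultimately show ?thesis
    using True by (simp add: upper_entropy_dim_partition_def)
next
  case False
  then have "upper_entropy_dim_partition M T \<alpha> = 0" by (simp add: upper_entropy_dim_partition_def)
  then show ?thesis using upper_entropy_dim_partition_bounds(1) by simp
qed

lemma joining_pair_measure: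
  assumes "mds M T" "mds N S"
  shows "joining M T N S (M \<Otimes>\<^sub>M N)"
proof -
  interpret X: mds M T by fact
  interpret Y: mds N S by fact
  interpret P: pair_prob_space M N ..
  have "distr (M \<Otimes>\<^sub>M N) (M \<Otimes>\<^sub>M N) (map_prod T S) = distr M M T \<Otimes>\<^sub>M distr N N S"
    unfolding map_prod_def
    by (rule pair_measure_distr[symmetric, OF X.measurable_T Y.measurable_T])
      (simp add: Y.preserves_T Y.sigma_finite_measure_axioms)
  moreover have "distr (M \<Otimes>\<^sub>M N) N snd = N"
  proof (rule measure_eqI)
    fix E assume "E \<in> sets (distr (M \<Otimes>\<^sub>M N) N snd)"
    then have E: "E \<in> sets N" by simp
    have "snd -` E \<inter> space (M \<Otimes>\<^sub>M N) = space M \<times> E"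
      using sets.sets_into_space[OF E] by (auto simp: space_pair_measure)
    then show "emeasure (distr (M \<Otimes>\<^sub>M N) N snd) E = emeasure N E"
      using E by (simp add: emeasure_distr Y.emeasure_pair_measure_Times X.emeasure_space_1)
  qed simp
  ultimately show ?thesis
    by (simp add: joining_def X.preserves_T Y.preserves_T Y.distr_pair_fst P.prob_space_axioms)
qed

theorem theorem3p6:
  fixes M :: "'a measure" and T :: "'a \<Rightarrow> 'a"
    and N :: "'b measure" and S :: "'b \<Rightarrow> 'b"
  assumes "invertible_mds M T"
    and "ergodic_mds N S"
    and "\<And>\<tau>. \<tau> \<in> Dims M T \<Longrightarrow> \<tau> > upper_entropy_dim N S"
  shows "disjoint_systems M T N S"
proof -
  interpret X: invertible_mds M T by fact
  interpret Y: ergodic_mds N S by fact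
  have "\<rho> = M \<Otimes>\<^sub>M N" if j: "joining M T N S \<rho>" for \<rho>
  proof (rule ccontr)
    assume "\<rho> \<noteq> M \<Otimes>\<^sub>M N"
    interpret joined_systems M T N S \<rho> by unfold_locales (rule j)
    obtain B t where B: "B \<in> sets N" "0 < measure N B" "measure N B < 1"
      and A: "0 < measure M {x \<in> space M. t < fiber_prob B x}" "measure M {x \<in> space M. t < fiber_prob B x} < 1"
      and atom: "measure M {x \<in> space M. fiber_prob B x = t} = 0"
      using dependent_threshold[OF \<open>\<rho> \<noteq> M \<Otimes>\<^sub>M N\<close>] by blast
    define A where "A = {x \<in> space M. t < fiber_prob B x}"
    have [measurable]: "fiber_prob B \<in> borel_measurable M" using fiber_prob_integrable[OF B(1)] by simp
    have "A \<in> sets M" unfolding A_def by measurable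
    then have "upper_entropy_dim_partition M T {A, space M - A} \<in> Dims M T"
      using A by (auto simp: Dims_def A_def)
    then have "upper_entropy_dim N S < upper_entropy_dim_partition M T {A, space M - A}"
      by (rule assms(3))
    also have "\<dots> \<le> upper_entropy_dim_partition N S {B, space N - B}"
      by (rule upper_entropy_dim_partition_mono) (use generating_transfer[OF B(1) atom] in \<open>simp add: A_def\<close>)
    also have "\<dots> \<le> upper_entropy_dim N S"
      by (intro upper_entropy_dim_partition_le partition_in_finite_partitions B Y.prob_space_axioms)
    finally show False by simp
  qed
  moreover have "joining M T N S (M \<Otimes>\<^sub>M N)"
    by (rule joining_pair_measure) (rule X.mds_axioms Y.mds_axioms)+
  ultimately show ?thesis unfolding disjoint_systems_def by blast
qed

end
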